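(* Let $\mathcal{K}$ be a directed $2$-complex. The map $\xi$ is a bijection between the set $\Omega_+(\mathcal{K})$ of positive paths in $\mathcal{K}$ and the realization of the semi-cubical complex $\mathrm{Sq}(\mathcal{K})$. Moreover, for any positive path $$p=u_0f^{(1)}_{t_1}u_1\cdots f^{(n)}_{t_n}u_n$$ in $\Omega_+(\mathcal{K})$, where $u_i$ are $1$-paths in $\mathcal{K}$ $(0\le i\le n)$, $f^{(i)}$ are $2$-cells of $\mathcal{K}$ and $t_i\in[0,1]$ $(1\le i\le n)$, the point $\xi(p)$ has coordinates $(t_1,\ldots,t_n)$ in the $n$-cube $\varepsilon(u_0)+f^{(1)}+\varepsilon(u_1)+\cdots+f^{(n)}+\varepsilon(u_n)$.
   Context: Directed $2$-complexes. A directed $2$-complex $\mathcal{K}$ is a directed graph together with a set $\mathbf{F}$ of $2$-cells and maps $\lceil\cdot\rceil,\lfloor\cdot\rfloor\colon\mathbf{F}\to\mathbf{P}$ (top, bottom), ${}^{-1}\colon\mathbf{F}\to\mathbf{F}$ (inverse), where $\mathbf{P}$ is the set of all directed paths of the graph including empty paths (called $1$-paths; initial and terminal vertices are $\iota(p),\tau(p)$). It is required that for each $f$ the paths $\lceil f\rceil,\lfloor f\rfloor$ are non-empty with common initial vertex $\iota(f)$ and common terminal vertex $\tau(f)$, and that ${}^{-1}$ is an involution without fixed points with $\lceil f^{-1}\rceil=\lfloor f\rfloor$, $\lfloor f^{-1}\rfloor=\lceil f\rceil$. An orientation $\mathbf{F}=\mathbf{F}^+\sqcup\mathbf{F}^-$,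 $\mathbf{F}^-=(\mathbf{F}^+)^{-1}$, is fixed (positive and negative $2$-cells). Squier complex. A semi-cubical complex is a family of disjoint sets $M_n$ ($n\ge0$) of $n$-cubes with face maps $\lambda_i^k\colon M_n\to M_{n-1}$ ($1\le i\le n$, $k=0,1$) satisfying $\lambda^k_i\lambda^{k'}_j=\lambda^{k'}_{j-1}\lambda^k_i$ for $i<j$ (the rightmost map acts first). Its realization is the quotient of the disjoint union of Euclidean cubes $c(x)\cong[0,1]^n$, one for each $x\in M_n$, obtained by identifying pointwise the face $[0,1]^{i-1}\times\{k\}\times[0,1]^{n-i}$ of $c(x)$ with $c(\lambda_i^k(x))$. $\mathrm{Sq}(\mathcal{K})$ is the semi-cubical complex whose $n$-cubes are the thin diagrams with $n$ cells, i.e. formal sums $c=\varepsilon(u_0)+f^{(1)}+\varepsilon(u_1)+\cdots+f^{(n)}+\varepsilon(u_n)$ with $u_i$ $1$-paths (possibly empty), $f^{(i)}\in\mathbf{F}^-$, $\tau(u_{i-1})=\iota(f^{(i)})$, $\tau(f^{(i)})=\iota(u_i)$. The face $\lambda_i^0(c)$ (resp. $\lambda_i^1(c)$) is obtained from $c$ by replacing $\varepsilon(u_{i-1})+f^{(i)}+\varepsilon(u_i)$ by $\varepsilon(u_{i-1}\lceil f^{(i)}\rceil u_i)$ (resp. $\varepsilon(u_{i-1}\lfloor f^{(i)}\rfloor u_i)$). A thin diagram in which some $f^{(i)}$ are positive denotes the same cube as the one with these $f^{(i)}$ replaced by their inverses, with a changed reference point: the corresponding coordinates $t_i$ are replaced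 by $1-t_i$. Positive paths. Realize $\mathcal{K}$ by attaching for each $f\in\mathbf{F}^+$ the square $D=[0,1]^2$ so that the path $d_0(s)=(s,0)$ is identified with $\lceil f\rceil$, $d_1(s)=(s,1)$ with $\lfloor f\rfloor$, all points $(0,t)$ are collapsed to $\iota(f)$, and all points $(1,t)$ to $\tau(f)$. For $t\in[0,1]$, $f_t$ is the image of the path $d_t(s)=(s,t)$, so $f_0=\lceil f\rceil$, $f_1=\lfloor f\rfloor$; put $(f^{-1})_t=f_{1-t}$. A positive path is a finite product $p_1\cdots p_n$ ($n\ge1$) with each $p_i$ either a $1$-path or of the form $f_t$ ($f\in\mathbf{F}$, $t\in[0,1]$), the end of $p_i$ being the beginning of $p_{i+1}$; $\Omega_+(\mathcal{K})$ is the set of all positive paths. Every positive path can be uniquely written in normal form $p=u_0f^{(1)}_{t_1}u_1\cdots f^{(n)}_{t_n}u_n$ with $u_i$ $1$-paths, $f^{(i)}\in\mathbf{F}^-$, $t_i\in(0,1)$. The map $\xi$ sends $p$ (in normal form) to the point with coordinates $(t_1,\dots,t_n)$ in the $n$-cube $\varepsilon(u_0)+f^{(1)}+\cdots+f^{(n)}+\varepsilon(u_n)$ of the realization of $\mathrm{Sq}(\mathcal{K})$. *)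

theory Defs
  imports Complex_Main "Graph_Theory.Arc_Walk"
begin

section \<open>Directed 2-complexes\<close>

text \<open>A 1-path is given by its initial vertex and its list of arcs; the vertex is needed to
  distinguish the empty paths.\<close>

type_synonym ('v, 'e) path1 = "'v \<times> 'e list"

definition path1_init :: "('v, 'e) path1 \<Rightarrow> 'v" where
  "path1_init u = fst u"

definition path1_term :: "('v, 'e) pre_digraph \<Rightarrow> ('v, 'e) path1 \<Rightarrow> 'v" where
  "path1_term G u = pre_digraph.awlast G (fst u) (snd u)"

definition paths1 :: "('v, 'e) pre_digraph \<Rightarrow> ('v, 'e) path1 set" where
  "paths1 G = {u. pre_digraph.awalk G (path1_init u) (snd u) (path1_term G u)}"

definition path1_mult :: "('v, 'e) path1 \<Rightarrow> ('v, 'e) path1 \<Rightarrow> ('v, 'e) path1"  (infixr \<open>\<cdot>\<^sub>1\<close> 70) where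
  "u \<cdot>\<^sub>1 w = (fst u, snd u @ snd w)"

record ('v, 'e, 'f) dir_complex =
  dgraph :: "('v, 'e) pre_digraph"
  cells :: "'f set"
  ctop :: "'f \<Rightarrow> ('v, 'e) path1"
  cbot :: "'f \<Rightarrow> ('v, 'e) path1"
  cinv :: "'f \<Rightarrow> 'f"
  pos_cells :: "'f set"

definition neg_cells :: "('v, 'e, 'f) dir_complex \<Rightarrow> 'f set" where
  "neg_cells K = cinv K ` pos_cells K"

definition cell_init :: "('v, 'e, 'f) dir_complex \<Rightarrow> 'f \<Rightarrow> 'v" where
  "cell_init K f = path1_init (ctop K f)"

definition cell_term :: "('v, 'e, 'f) dir_complex \<Rightarrow> 'f \<Rightarrow> 'v" where
  "cell_term K f = path1_term (dgraph K) (ctop K f)"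

locale directed_2_complex =
  fixes K :: "('v, 'e, 'f) dir_complex"
  assumes wf_graph: "wf_digraph (dgraph K)"
    and top_path: "f \<in> cells K \<Longrightarrow> ctop K f \<in> paths1 (dgraph K) \<and> snd (ctop K f) \<noteq> []"
    and bot_path: "f \<in> cells K \<Longrightarrow> cbot K f \<in> paths1 (dgraph K) \<and> snd (cbot K f) \<noteq> []"
    and same_init: "f \<in> cells K \<Longrightarrow> path1_init (ctop K f) = path1_init (cbot K f)"
    and same_term: "f \<in> cells K \<Longrightarrow>
      path1_term (dgraph K) (ctop K f) = path1_term (dgraph K) (cbot K f)"
    and inv_cell: "f \<in> cells K \<Longrightarrow> cinv K f \<in> cells K"
    and inv_inv: "f \<in> cells K \<Longrightarrow> cinv K (cinv K f) = f"
    and inv_neq: "f \<in> cells K \<Longrightarrow> cinv K f \<noteq> f"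
    and top_inv: "f \<in> cells K \<Longrightarrow> ctop K (cinv K f) = cbot K f"
    and bot_inv: "f \<in> cells K \<Longrightarrow> cbot K (cinv K f) = ctop K f"
    and orient_union: "pos_cells K \<union> neg_cells K = cells K"
    and orient_disjoint: "pos_cells K \<inter> neg_cells K = {}"


section \<open>Semi-cubical complexes and their realizations\<close>

text \<open>In \<open>face S i k x\<close> the index \<open>i\<close> is the lower and \<open>k\<close> the upper index of the face map.\<close>

record 'c cubical =
  cubes :: "nat \<Rightarrow> 'c set"
  face :: "nat \<Rightarrow> nat \<Rightarrow> 'c \<Rightarrow> 'c"

locale semi_cubical_complex =
  fixes S :: "'c cubical"
  assumes cubes_disjoint: "m \<noteq> n \<Longrightarrow> cubes S m \<inter> cubes S n = {}"
    and face_cube: "\<lbrakk>x \<in> cubes S n; 1 \<le> i; i \<le> n; k \<in> {0, 1}\<rbrakk> \<Longrightarrow> face S i k x \<in> cubes S (n - 1)"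
    and face_face: "\<lbrakk>x \<in> cubes S n; 1 \<le> i; i < j; j \<le> n; k \<in> {0, 1}; k' \<in> {0, 1}\<rbrakk> \<Longrightarrow>
      face S i k (face S j k' x) = face S (j - 1) k' (face S i k x)"

text \<open>A pair \<open>(x, ts)\<close> is the point with coordinates \<open>ts\<close> of the Euclidean cube \<open>c(x)\<close>. Only the
  set of points of the realization is needed, so its topology is not introduced.\<close>

definition cube_points :: "'c cubical \<Rightarrow> ('c \<times> real list) set" where
  "cube_points S = {(x, ts). x \<in> cubes S (length ts) \<and> set ts \<subseteq> {0..1}}"

inductive face_glue :: "'c cubical \<Rightarrow> 'c \<times> real list \<Rightarrow> 'c \<times> real list \<Rightarrow> bool" for S where
  "\<lbrakk>(x, ts) \<in> cube_points S; 1 \<le> i; i \<le> length ts; k \<in> {0, 1}; ts ! (i - 1) = real k\<rbrakk> \<Longrightarrow>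
    face_glue S (x, ts) (face S i k x, take (i - 1) ts @ drop i ts)"

definition real_point :: "'c cubical \<Rightarrow> 'c \<Rightarrow> real list \<Rightarrow> ('c \<times> real list) set" where
  "real_point S x ts = {q. equivclp (face_glue S) (x, ts) q}"

definition realization :: "'c cubical \<Rightarrow> ('c \<times> real list) set set" where
  "realization S = {real_point S x ts | x ts. (x, ts) \<in> cube_points S}"


section \<open>The Squier complex\<close>

text \<open>The thin diagram $\varepsilon(u_0)+f^{(1)}+\varepsilon(u_1)+\cdots+f^{(n)}+\varepsilon(u_n)$ is
  the pair \<open>([u\<^sub>0, \<dots>, u\<^sub>n], [f\<^sup>1, \<dots>, f\<^sup>n])\<close>; lists being indexed from 0, its $i$-th cell is
  \<open>fs ! (i - 1)\<close>. The set \<open>A\<close> contains the cells that may be used.\<close>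

type_synonym ('v, 'e, 'f) thin = "('v, 'e) path1 list \<times> 'f list"

definition thin_diagrams :: "('v, 'e, 'f) dir_complex \<Rightarrow> 'f set \<Rightarrow> ('v, 'e, 'f) thin set" where
  "thin_diagrams K A = {(us, fs).
     length us = length fs + 1 \<and> set us \<subseteq> paths1 (dgraph K) \<and> set fs \<subseteq> A \<and>
     (\<forall>i \<in> {1..length fs}.
        path1_term (dgraph K) (us ! (i - 1)) = cell_init K (fs ! (i - 1)) \<and>
        cell_term K (fs ! (i - 1)) = path1_init (us ! i))}"

fun thin_face :: "('v, 'e, 'f) dir_complex \<Rightarrow> nat \<Rightarrow> nat \<Rightarrow> ('v, 'e, 'f) thin \<Rightarrow> ('v, 'e, 'f) thin" where
  "thin_face K i k (us, fs) =
    (take (i - 1) us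
       @ [us ! (i - 1) \<cdot>\<^sub>1 (if k = 0 then ctop K else cbot K) (fs ! (i - 1)) \<cdot>\<^sub>1 us ! i]
       @ drop (i + 1) us,
     take (i - 1) fs @ drop i fs)"

definition Sq :: "('v, 'e, 'f) dir_complex \<Rightarrow> ('v, 'e, 'f) thin cubical" where
  "Sq K = \<lparr>cubes = (\<lambda>n. {c \<in> thin_diagrams K (neg_cells K). length (snd c) = n}),
           face = thin_face K\<rparr>"

text \<open>The point with coordinates \<open>ts\<close> in the cube denoted by a thin diagram that may have positive
  cells: these are replaced by their inverses and the corresponding coordinates $t$ by $1-t$.\<close>

definition thin_point ::
  "('v, 'e, 'f) dir_complex \<Rightarrow> ('v, 'e, 'f) thin \<Rightarrow> real list \<Rightarrow> (('v, 'e, 'f) thin \<times> real list) set"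
  where
  "thin_point K c ts = real_point (Sq K)
     (fst c, map (\<lambda>f. if f \<in> pos_cells K then cinv K f else f) (snd c))
     (map2 (\<lambda>f t. if f \<in> pos_cells K then 1 - t else t) (snd c) ts)"


section \<open>Paths with a length\<close>

text \<open>A path of length $l \ge 0$ is a pair \<open>(l, g)\<close>, where only the restriction of \<open>g\<close> to $[0,l]$
  matters. As the lengths of the paths add up, their product is associative, and the paths of
  length 0 are neutral.\<close>

type_synonym 'p mpath = "real \<times> (real \<Rightarrow> 'p)"

definition mstart :: "'p mpath \<Rightarrow> 'p" where
  "mstart p = snd p 0"

definition mend :: "'p mpath \<Rightarrow> 'p" where
  "mend p = snd p (fst p)"

definition mmult :: "'p mpath \<Rightarrow> 'p mpath \<Rightarrow> 'p mpath"  (infixr \<open>\<star>\<close> 70) where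
  "p \<star> q = (fst p + fst q, \<lambda>s. if s \<le> fst p then snd p s else snd q (s - fst p))"

text \<open>Paths are considered up to orientation-preserving reparametrization. A strictly increasing
  map of one interval onto another one is automatically a homeomorphism.\<close>

definition reparam :: "'p mpath \<Rightarrow> 'p mpath \<Rightarrow> bool" where
  "reparam p q \<longleftrightarrow> (\<exists>\<phi>. strict_mono_on {0..fst p} \<phi> \<and> \<phi> ` {0..fst p} = {0..fst q} \<and>
     (\<forall>s \<in> {0..fst p}. snd q (\<phi> s) = snd p s))"

definition mclass :: "'p mpath \<Rightarrow> 'p mpath set" where
  "mclass p = {q. reparam p q}"


section \<open>The realization of a directed 2-complex and its positive paths\<close>

text \<open>The points before gluing: vertices, points of the arcs $[0,1]$ and points $(s,t)$ of the
  squares $[0,1]^2$ belonging to the positive 2-cells.\<close>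

datatype ('v, 'e, 'f) prepoint = Vertex 'v | Arc_Point 'e real | Cell_Point 'f real real

fun prewalk :: "('v, 'e) pre_digraph \<Rightarrow> ('v, 'e) path1 \<Rightarrow> ('v, 'e, 'f) prepoint mpath" where
  "prewalk G (v, []) = (0, \<lambda>_. Vertex v)"
| "prewalk G (v, e # es) = (1, Arc_Point e) \<star> prewalk G (head G e, es)"

definition prewalk_at :: "('v, 'e) pre_digraph \<Rightarrow> ('v, 'e) path1 \<Rightarrow> real \<Rightarrow> ('v, 'e, 'f) prepoint" where
  "prewalk_at G u s = snd (prewalk G u) (s * fst (prewalk G u :: ('v, 'e, 'f) prepoint mpath))"

inductive cell_glue :: "('v, 'e, 'f) dir_complex \<Rightarrow>
    ('v, 'e, 'f) prepoint \<Rightarrow> ('v, 'e, 'f) prepoint \<Rightarrow> bool" for K where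
  "e \<in> arcs (dgraph K) \<Longrightarrow> cell_glue K (Arc_Point e 0) (Vertex (tail (dgraph K) e))"
| "e \<in> arcs (dgraph K) \<Longrightarrow> cell_glue K (Arc_Point e 1) (Vertex (head (dgraph K) e))"
| "\<lbrakk>f \<in> pos_cells K; s \<in> {0..1}\<rbrakk> \<Longrightarrow>
    cell_glue K (Cell_Point f s 0) (prewalk_at (dgraph K) (ctop K f) s)"
| "\<lbrakk>f \<in> pos_cells K; s \<in> {0..1}\<rbrakk> \<Longrightarrow>
    cell_glue K (Cell_Point f s 1) (prewalk_at (dgraph K) (cbot K f) s)"
| "\<lbrakk>f \<in> pos_cells K; t \<in> {0..1}\<rbrakk> \<Longrightarrow> cell_glue K (Cell_Point f 0 t) (Vertex (cell_init K f))"
| "\<lbrakk>f \<in> pos_cells K; t \<in> {0..1}\<rbrakk> \<Longrightarrow> cell_glue K (Cell_Point f 1 t) (Vertex (cell_term K f))"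

type_synonym ('v, 'e, 'f) point = "('v, 'e, 'f) prepoint set"

definition cpoint :: "('v, 'e, 'f) dir_complex \<Rightarrow> ('v, 'e, 'f) prepoint \<Rightarrow> ('v, 'e, 'f) point" where
  "cpoint K x = {y. equivclp (cell_glue K) x y}"

definition walk_path ::
  "('v, 'e, 'f) dir_complex \<Rightarrow> ('v, 'e) path1 \<Rightarrow> ('v, 'e, 'f) point mpath" where
  "walk_path K u = (fst (prewalk (dgraph K) u :: ('v, 'e, 'f) prepoint mpath),
     \<lambda>s. cpoint K (snd (prewalk (dgraph K) u) s))"

text \<open>The path $f_t$; for a negative cell it is $(f^{-1})_{1-t}$.\<close>

definition cell_path ::
  "('v, 'e, 'f) dir_complex \<Rightarrow> 'f \<Rightarrow> real \<Rightarrow> ('v, 'e, 'f) point mpath" where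
  "cell_path K f t = (1, \<lambda>s. cpoint K
     (if f \<in> pos_cells K then Cell_Point f s t else Cell_Point (cinv K f) s (1 - t)))"

definition elem_paths :: "('v, 'e, 'f) dir_complex \<Rightarrow> ('v, 'e, 'f) point mpath set" where
  "elem_paths K = {walk_path K u | u. u \<in> paths1 (dgraph K)} \<union>
     {cell_path K f t | f t. f \<in> cells K \<and> t \<in> {0..1}}"

inductive_set pos_products :: "('v, 'e, 'f) dir_complex \<Rightarrow> ('v, 'e, 'f) point mpath set" for K where
  "p \<in> elem_paths K \<Longrightarrow> p \<in> pos_products K"
| "\<lbrakk>p \<in> elem_paths K; q \<in> pos_products K; mend p = mstart q\<rbrakk> \<Longrightarrow> p \<star> q \<in> pos_products K"

definition Omega_plus :: "('v, 'e, 'f) dir_complex \<Rightarrow> ('v, 'e, 'f) point mpath set set" where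
  "Omega_plus K = mclass ` pos_products K"

text \<open>The product $u_0 f^{(1)}_{t_1} u_1 \cdots f^{(n)}_{t_n} u_n$.\<close>

fun thin_path ::
  "('v, 'e, 'f) dir_complex \<Rightarrow> ('v, 'e, 'f) thin \<Rightarrow> real list \<Rightarrow> ('v, 'e, 'f) point mpath" where
  "thin_path K ([u], []) [] = walk_path K u"
| "thin_path K (u # us, f # fs) (t # ts) =
     walk_path K u \<star> cell_path K f t \<star> thin_path K (us, fs) ts"

definition normal_form ::
  "('v, 'e, 'f) dir_complex \<Rightarrow> ('v, 'e, 'f) point mpath set \<Rightarrow> ('v, 'e, 'f) thin \<Rightarrow> real list \<Rightarrow> bool"
  where
  "normal_form K p c ts \<longleftrightarrow> c \<in> thin_diagrams K (neg_cells K) \<and> length ts = length (snd c) \<and>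
     set ts \<subseteq> {0<..<1} \<and> p = mclass (thin_path K c ts)"

definition xi ::
  "('v, 'e, 'f) dir_complex \<Rightarrow> ('v, 'e, 'f) point mpath set \<Rightarrow> (('v, 'e, 'f) thin \<times> real list) set"
  where
  "xi K p = (let (c, ts) = (THE (c, ts). normal_form K p c ts) in real_point (Sq K) c ts)"

section \<open>Consistency of the definitions\<close>

text \<open>\<open>Sq K\<close> is a semi-cubical complex, and the paths $f_t$ satisfy $f_0 = \lceil f\rceil$ and
  $f_1 = \lfloor f\rfloor$.\<close>

context directed_2_complex
begin

lemma neg_cells_subset: "neg_cells K \<subseteq> cells K"
  using orient_union by blast

lemma paths1_iff: "u \<in> paths1 (dgraph K) \<longleftrightarrow>
    pre_digraph.awalk (dgraph K) (path1_init u) (snd u) (path1_term (dgraph K) u)"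
  by (simp add: paths1_def)

lemma path1_mult:
  assumes "u \<in> paths1 (dgraph K)" "w \<in> paths1 (dgraph K)" "path1_term (dgraph K) u = path1_init w"
  shows "u \<cdot>\<^sub>1 w \<in> paths1 (dgraph K)" "path1_init (u \<cdot>\<^sub>1 w) = path1_init u"
    "path1_term (dgraph K) (u \<cdot>\<^sub>1 w) = path1_term (dgraph K) w"
proof -
  interpret wf_digraph "dgraph K" by (rule wf_graph)
  have *: "awalk (fst u) (snd u @ snd w) (path1_term (dgraph K) w)"
    using assms awalk_appendI by (auto simp: paths1_iff path1_init_def)
  then have "awlast (fst u) (snd u @ snd w) = path1_term (dgraph K) w"
    by auto
  then show "path1_term (dgraph K) (u \<cdot>\<^sub>1 w) = path1_term (dgraph K) w"
    by (simp add: path1_term_def path1_mult_def)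
  with * show "u \<cdot>\<^sub>1 w \<in> paths1 (dgraph K)"
    by (simp add: paths1_iff path1_init_def path1_mult_def)
  show "path1_init (u \<cdot>\<^sub>1 w) = path1_init u" by (simp add: path1_init_def path1_mult_def)
qed

lemma nth_drop_one: "m < length xs \<Longrightarrow> j < length xs - 1 \<Longrightarrow>
    (take m xs @ drop (Suc m) xs) ! j = (if j < m then xs ! j else xs ! Suc j)"
  by (simp add: nth_append min_def)

lemma nth_middle_list: "Suc m < length xs \<Longrightarrow> j < length xs - 1 \<Longrightarrow>
    (take m xs @ w # drop (Suc (Suc m)) xs) ! j = (if j < m then xs ! j else if j = m then w else xs ! Suc j)"
proof (cases "j \<le> m")
  case False
  then obtain d where "j = Suc (m + d)" by (metis less_imp_Suc_add not_le)
  then show "Suc m < length xs \<Longrightarrow> j < length xs - 1 \<Longrightarrow> ?thesis" by (simp add: nth_append)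
qed (simp add: nth_append)

lemma path1_mult_assoc: "(u \<cdot>\<^sub>1 w) \<cdot>\<^sub>1 x = u \<cdot>\<^sub>1 w \<cdot>\<^sub>1 x"
  by (simp add: path1_mult_def)

lemma thin_face_in:
  assumes c: "(us, fs) \<in> thin_diagrams K A" and A: "A \<subseteq> cells K"
    and i: "1 \<le> i" "i \<le> length fs"
  shows "thin_face K i k (us, fs) \<in> thin_diagrams K A"
proof -
  define f where "f = fs ! (i - 1)"
  define b where "b = (if k = 0 then ctop K else cbot K) f"
  define w where "w = us ! (i - 1) \<cdot>\<^sub>1 b \<cdot>\<^sub>1 us ! i"
  have len: "length us = length fs + 1" and us0: "set us \<subseteq> paths1 (dgraph K)" and fs: "set fs \<subseteq> A"
    and ch0: "\<And>j. j \<in> {1..length fs} \<Longrightarrow>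
       path1_term (dgraph K) (us ! (j - 1)) = cell_init K (fs ! (j - 1)) \<and>
        cell_term K (fs ! (j - 1)) = path1_init (us ! j)"
    using c by (auto simp: thin_diagrams_def)
  have us: "us ! j \<in> paths1 (dgraph K)" if "j \<le> length fs" for j
    using us0 len that by (metis Suc_eq_plus1 less_Suc_eq_le nth_mem subsetD)
  have ch: "path1_term (dgraph K) (us ! j) = cell_init K (fs ! j) \<and>
        cell_term K (fs ! j) = path1_init (us ! Suc j)" if "j < length fs" for j
    using ch0[of "Suc j"] that by simp
  have f: "f \<in> cells K" using fs A i by (metis One_nat_def Suc_le_lessD Suc_pred f_def nth_mem subsetD)
  have b: "b \<in> paths1 (dgraph K)" "path1_init b = cell_init K f" "path1_term (dgraph K) b = cell_term K f"
    using top_path[OF f] bot_path[OF f] same_init[OF f] same_term[OF f]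
    by (auto simp: b_def cell_init_def cell_term_def)
  have chi: "path1_term (dgraph K) (us ! (i - 1)) = cell_init K f" "cell_term K f = path1_init (us ! i)"
    using ch[of "i - 1"] i by (auto simp: f_def)
  have bu: "b \<cdot>\<^sub>1 us ! i \<in> paths1 (dgraph K)" "path1_init (b \<cdot>\<^sub>1 us ! i) = cell_init K f"
    "path1_term (dgraph K) (b \<cdot>\<^sub>1 us ! i) = path1_term (dgraph K) (us ! i)"
    using path1_mult[OF b(1) us[of i]] b chi i by auto
  have w: "w \<in> paths1 (dgraph K)" "path1_init w = path1_init (us ! (i - 1))"
    "path1_term (dgraph K) w = path1_term (dgraph K) (us ! i)"
    using path1_mult[OF us[of "i - 1"] bu(1)] bu chi i by (auto simp: w_def)
  have eq: "thin_face K i k (us, fs) = (take (i - 1) us @ [w] @ drop (i + 1) us, take (i - 1) fs @ drop i fs)"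
    by (simp add: w_def b_def f_def)
  obtain m where m: "i = Suc m" using i by (cases i) auto
  have s: "set (take (i - 1) us @ [w] @ drop (i + 1) us) \<subseteq> paths1 (dgraph K)"
    using w c by (auto simp: thin_diagrams_def dest: in_set_takeD in_set_dropD)
  have t: "set (take (i - 1) fs @ drop i fs) \<subseteq> A"
    using fs by (auto dest: in_set_takeD in_set_dropD)
  have n: "(take (i - 1) us @ [w] @ drop (i + 1) us) ! j =
      (if j < m then us ! j else if j = m then w else us ! Suc j)" if "j < length fs" for j
    using that i len nth_middle_list[of m us j w] by (simp add: m)
  have n': "(take (i - 1) fs @ drop i fs) ! j = (if j < m then fs ! j else fs ! Suc j)"
    if "j < length fs - 1" for j
    using that i nth_drop_one[of m fs j] by (simp add: m)
  have "path1_term (dgraph K) ((take (i - 1) us @ [w] @ drop (i + 1) us) ! j)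
          = cell_init K ((take (i - 1) fs @ drop i fs) ! j) \<and>
        cell_term K ((take (i - 1) fs @ drop i fs) ! j)
          = path1_init ((take (i - 1) us @ [w] @ drop (i + 1) us) ! Suc j)" if j: "j < length fs - 1" for j
    using ch[of j] ch[of "Suc j"] w j m n[of j] n[of "Suc j"] n'[OF j] by auto
  note n2 = this
  have "\<forall>j \<in> {1..length (take (i - 1) fs @ drop i fs)}.
      path1_term (dgraph K) ((take (i - 1) us @ [w] @ drop (i + 1) us) ! (j - 1))
          = cell_init K ((take (i - 1) fs @ drop i fs) ! (j - 1)) \<and>
        cell_term K ((take (i - 1) fs @ drop i fs) ! (j - 1))
          = path1_init ((take (i - 1) us @ [w] @ drop (i + 1) us) ! j)"
  proof
    fix j assume j: "j \<in> {1..length (take (i - 1) fs @ drop i fs)}"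
    then obtain l where l: "j = Suc l" by (cases j) auto
    then have "l < length fs - 1" using j i by auto
    from n2[OF this] show "path1_term (dgraph K) ((take (i - 1) us @ [w] @ drop (i + 1) us) ! (j - 1))
          = cell_init K ((take (i - 1) fs @ drop i fs) ! (j - 1)) \<and>
        cell_term K ((take (i - 1) fs @ drop i fs) ! (j - 1))
          = path1_init ((take (i - 1) us @ [w] @ drop (i + 1) us) ! j)"
      by (simp add: l)
  qed
  with s t len i show ?thesis
    unfolding eq thin_diagrams_def by auto
qed

lemma thin_face_nth:
  assumes "length us = length fs + 1" "1 \<le> i" "i \<le> length fs"
  shows "length (fst (thin_face K i k (us, fs))) = length fs"
    "length (snd (thin_face K i k (us, fs))) = length fs - 1"
    "l < length fs \<Longrightarrow> fst (thin_face K i k (us, fs)) ! l =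
      (if l < i - 1 then us ! l
       else if l = i - 1 then us ! l \<cdot>\<^sub>1 (if k = 0 then ctop K else cbot K) (fs ! l) \<cdot>\<^sub>1 us ! Suc l
       else us ! Suc l)"
    "l < length fs - 1 \<Longrightarrow> snd (thin_face K i k (us, fs)) ! l = (if l < i - 1 then fs ! l else fs ! Suc l)"
proof -
  obtain m where m: "i = Suc m" using assms(2) by (cases i) auto
  show "length (fst (thin_face K i k (us, fs))) = length fs"
    "length (snd (thin_face K i k (us, fs))) = length fs - 1"
    using assms by (simp_all add: m)
  show "fst (thin_face K i k (us, fs)) ! l =
      (if l < i - 1 then us ! l
       else if l = i - 1 then us ! l \<cdot>\<^sub>1 (if k = 0 then ctop K else cbot K) (fs ! l) \<cdot>\<^sub>1 us ! Suc l
       else us ! Suc l)" if "l < length fs"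
    using assms that by (simp add: m nth_middle_list)
  show "snd (thin_face K i k (us, fs)) ! l = (if l < i - 1 then fs ! l else fs ! Suc l)"
    if "l < length fs - 1"
    using assms that by (simp add: m nth_drop_one)
qed

lemma thin_face_face:
  assumes len: "length us = length fs + 1" and ij: "1 \<le> i" "i < j" "j \<le> length fs"
  shows "thin_face K i k (thin_face K j k' (us, fs)) = thin_face K (j - 1) k' (thin_face K i k (us, fs))"
proof -
  obtain m where m: "i = Suc m" using ij by (cases i) auto
  obtain n where n: "j = Suc (Suc n)" using that[of "j - 2"] ij m by simp
  obtain us1 fs1 where 1: "thin_face K j k' (us, fs) = (us1, fs1)" by fastforce
  obtain us2 fs2 where 2: "thin_face K i k (us, fs) = (us2, fs2)" by fastforce
  note a1 = thin_face_nth[OF len, where i = j and k = k', unfolded 1 fst_conv snd_conv]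
  note a2 = thin_face_nth[OF len, where i = i and k = k, unfolded 2 fst_conv snd_conv]
  have ij': "1 \<le> j" "i \<le> length fs" "1 \<le> j - 1" "j - 1 \<le> length fs - 1" "i \<le> length fs - 1"
    using ij by auto
  have l1: "length us1 = length fs1 + 1" "length fs1 = length fs - 1"
    and l2: "length us2 = length fs2 + 1" "length fs2 = length fs - 1"
    using a1(1,2) a2(1,2) ij by auto
  note b1 = thin_face_nth[OF l1(1), where i = i and k = k, unfolded l1(2), OF ij(1) ij'(5)]
  note b2 = thin_face_nth[OF l2(1), where i = "j - 1" and k = k', unfolded l2(2), OF ij'(3,4)]
  note a1' = a1(3,4)[OF ij'(1) ij(3)] and a2' = a2(3,4)[OF ij(1) ij'(2)]
  note [simp del] = thin_face.simps
  have "fst (thin_face K i k (us1, fs1)) = fst (thin_face K (j - 1) k' (us2, fs2))"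
  proof (rule nth_equalityI)
    fix l assume "l < length (fst (thin_face K i k (us1, fs1)))"
    then have l: "l < length fs - 1" using b1(1) by simp
    then have l': "l < length fs" "Suc l < length fs" by auto
    consider "l < m" | "l = m" "l < n" | "l = m" "l = n" | "m < l" "l < n" | "m < l" "l = n" | "n < l"
      using ij m n by linarith
    then show "fst (thin_face K i k (us1, fs1)) ! l = fst (thin_face K (j - 1) k' (us2, fs2)) ! l"
      unfolding b1(3)[OF l] b2(3)[OF l]
      by cases (use l l' ij m n in \<open>simp_all add: a1'[unfolded n] a2'[unfolded m] path1_mult_assoc\<close>)
  qed (use b1 b2 in simp)
  moreover have "snd (thin_face K i k (us1, fs1)) = snd (thin_face K (j - 1) k' (us2, fs2))"
  proof (rule nth_equalityI)
    fix l assume "l < length (snd (thin_face K i k (us1, fs1)))"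
    then have l: "l < length fs - 1 - 1" using b1(2) by simp
    then show "snd (thin_face K i k (us1, fs1)) ! l = snd (thin_face K (j - 1) k' (us2, fs2)) ! l"
      unfolding b1(4)[OF l] b2(4)[OF l]
      using ij m n l by (simp add: a1'[unfolded n] a2'[unfolded m])
  qed (use b1 b2 in simp)
  ultimately show ?thesis by (simp add: 1 2 prod_eq_iff)
qed

lemma semi_cubical_Sq: "semi_cubical_complex (Sq K)"
proof
  show "cubes (Sq K) m \<inter> cubes (Sq K) n = {}" if "m \<noteq> n" for m n
    using that by (auto simp: Sq_def)
  have cube: "x \<in> cubes (Sq K) n \<longleftrightarrow> x \<in> thin_diagrams K (neg_cells K) \<and> length (snd x) = n"
    and face: "face (Sq K) = thin_face K" for x n
    by (simp_all add: Sq_def)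
  have len: "length us = length fs + 1" if "(us, fs) \<in> thin_diagrams K (neg_cells K)" for us fs
    using that by (simp add: thin_diagrams_def)
  show "face (Sq K) i k x \<in> cubes (Sq K) (n - 1)"
    if x: "x \<in> cubes (Sq K) n" and i: "1 \<le> i" "i \<le> n" for x n i k
  proof -
    obtain us fs where xe: "x = (us, fs)" by fastforce
    with x have d: "(us, fs) \<in> thin_diagrams K (neg_cells K)" and n: "n = length fs" by (simp_all add: cube)
    show ?thesis unfolding cube face xe n
      using thin_face_in[OF d neg_cells_subset] thin_face_nth(2)[OF len[OF d]] i unfolding n by blast
  qed
  show "face (Sq K) i k (face (Sq K) j k' x) = face (Sq K) (j - 1) k' (face (Sq K) i k x)"
    if x: "x \<in> cubes (Sq K) n" and ij: "1 \<le> i" "i < j" "j \<le> n" for x n i j k k'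
  proof -
    obtain us fs where xe: "x = (us, fs)" by fastforce
    with x have d: "(us, fs) \<in> thin_diagrams K (neg_cells K)" and n: "n = length fs" by (simp_all add: cube)
    show ?thesis unfolding face xe
      by (rule thin_face_face[OF len[OF d]]) (use ij n in auto)
  qed
qed

lemma fst_prewalk: "fst (prewalk G u) = real (length (snd u))"
  by (induction G u rule: prewalk.induct) (simp_all add: mmult_def)

lemma cpoint_glue: "cell_glue K x y \<Longrightarrow> cpoint K x = cpoint K y"
  unfolding cpoint_def
  by (auto intro: equivclp_trans equivclp_sym)

lemma mclass_walk:
  assumes "snd u \<noteq> []" "\<And>s. s \<in> {0..1} \<Longrightarrow> g s = cpoint K (prewalk_at (dgraph K) u s)"
  shows "reparam (1, g) (walk_path K u)"
proof -
  define l where "l = real (length (snd u))"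
  have l: "l > 0" using assms(1) by (simp add: l_def)
  have "(\<lambda>s. s * l) ` {0..1} = {0..l}"
    using l by (simp add: image_mult_atLeastAtMost_if' )
  then show ?thesis using l assms(2)
    unfolding reparam_def walk_path_def
    by (intro exI[of _ "\<lambda>s. s * l"]) (auto simp: fst_prewalk prewalk_at_def strict_mono_on_def l_def)
qed

lemma cell_path_ends:
  assumes f: "f \<in> cells K"
  shows "reparam (cell_path K f 0) (walk_path K (ctop K f))"
    "reparam (cell_path K f 1) (walk_path K (cbot K f))"
proof -
  have inv: "cinv K f \<in> pos_cells K" if "f \<notin> pos_cells K"
  proof -
    have "f \<in> neg_cells K" using that f orient_union by blast
    then obtain g where g: "f = cinv K g" "g \<in> pos_cells K" by (auto simp: neg_cells_def)
    then have "g \<in> cells K" using orient_union by blast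
    with g show ?thesis by (simp add: inv_inv)
  qed
  show "reparam (cell_path K f 0) (walk_path K (ctop K f))"
    unfolding cell_path_def
  proof (rule mclass_walk)
    fix s :: real assume s: "s \<in> {0..1}"
    show "cpoint K (if f \<in> pos_cells K then Cell_Point f s 0 else Cell_Point (cinv K f) s (1 - 0)) =
      cpoint K (prewalk_at (dgraph K) (ctop K f) s)"
      using cell_glue.intros(3)[of f K s] cell_glue.intros(4)[of "cinv K f" K s] inv s bot_inv[OF f]
      by (auto intro!: cpoint_glue)
  qed (use top_path[OF f] in blast)
  show "reparam (cell_path K f 1) (walk_path K (cbot K f))"
    unfolding cell_path_def
  proof (rule mclass_walk)
    fix s :: real assume s: "s \<in> {0..1}"
    show "cpoint K (if f \<in> pos_cells K then Cell_Point f s 1 else Cell_Point (cinv K f) s (1 - 1)) =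
      cpoint K (prewalk_at (dgraph K) (cbot K f) s)"
      using cell_glue.intros(4)[of f K s] cell_glue.intros(3)[of "cinv K f" K s] inv s top_inv[OF f]
      by (auto intro!: cpoint_glue)
  qed (use bot_path[OF f] in blast)
qed

end

end

theory Submission
  imports Defs
begin

text \<open>
  Positive paths and points of the realization of \<open>Sq K\<close> are both described by words.
  A word is a vertex followed by a composable sequence of letters, where a letter is an arc or a path
  \<open>f\<^sub>t\<close> with a negative cell \<open>f\<close> and \<open>0 < t < 1\<close>.

  Every positive path is the path of a word up to reparametrization, since \<open>f\<^sub>0\<close>
  and \<open>f\<^sub>1\<close> are the 1-paths \<open>\<lceil>f\<rceil>\<close> and
  \<open>\<lfloor>f\<rfloor>\<close> (\<open>pos_product_word\<close>). The word is unique
  (\<open>word_path_inject\<close>): after gluing, the interior points of arcs and squares are still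
  distinct from one another and from the vertices, so a word path that spends one unit of time on each letter is at a vertex exactly at the
  integer times. A reparametrization between two such paths therefore fixes the integers, and a
  point in the interior of each unit interval determines the letter. Grouping consecutive arcs into
  1-paths turns the word into the normal form of the path, and back (\<open>word_normal_form\<close>,
  \<open>normal_form_determined_by_word\<close>).

  A point of a cube also has a word: read the thin diagram from left to right with \<open>f\<close>
  replaced by \<open>f\<^sub>t\<close>, that is by the top or bottom path of \<open>f\<close> if
  the coordinate \<open>t\<close> is 0 or 1. This is just what the face maps do, so glued points have
  the same word (\<open>equivclp_point_word\<close>); and every point is glued to one in the interior of a cube
  (\<open>cube_point_normal_form\<close>), which is a normal form and is thus determined by its word.
  Hence two points are glued if and only if their words agree.

  The map \<open>xi K\<close> sends a path to the point with the same word, whence it is bijective.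
  For an expression \<open>u\<^sub>0 f\<^sub>t \<dots>\<close> that is not a normal form, the path and the point
  with the coordinates read off from the expression still have the same word, which is the claim
  about coordinates.
\<close>

section \<open>Paths up to reparametrization\<close>

lemma reparam_same:
  assumes "fst p = fst q" "\<And>s. 0 \<le> s \<Longrightarrow> s \<le> fst p \<Longrightarrow> snd p s = snd q s"
  shows "reparam p q"
  using assms unfolding reparam_def
  by (intro exI[of _ "\<lambda>s. s"]) (auto simp: strict_mono_on_def)

lemma reparam_refl: "reparam p p"
  by (rule reparam_same) simp_all

lemma reparam_sym:
  assumes "reparam p q"
  shows "reparam q p"
proof -
  obtain \<phi> where mono: "strict_mono_on {0..fst p} \<phi>" and img: "\<phi> ` {0..fst p} = {0..fst q}"
    and val: "\<And>s. s \<in> {0..fst p} \<Longrightarrow> snd q (\<phi> s) = snd p s"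
    using assms by (auto simp: reparam_def)
  have inj: "inj_on \<phi> {0..fst p}"
    using mono by (rule strict_mono_on_imp_inj_on)
  define \<psi> where "\<psi> = inv_into {0..fst p} \<phi>"
  have inv: "\<psi> r \<in> {0..fst p}" "\<phi> (\<psi> r) = r" if "r \<in> {0..fst q}" for r
    using that img inv_into_into[of r \<phi> "{0..fst p}"] f_inv_into_f[of r \<phi> "{0..fst p}"]
    unfolding \<psi>_def by blast+
  have "strict_mono_on {0..fst q} \<psi>"
  proof (rule strict_mono_onI)
    fix r s assume rs: "r \<in> {0..fst q}" "s \<in> {0..fst q}" "r < s"
    show "\<psi> r < \<psi> s"
    proof (rule ccontr)
      assume "\<not> \<psi> r < \<psi> s"
      then have "\<phi> (\<psi> s) \<le> \<phi> (\<psi> r)"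
        using strict_mono_onD[OF mono inv(1)[OF rs(2)] inv(1)[OF rs(1)]] by (cases "\<psi> r = \<psi> s") auto
      with rs inv(2) show False by simp
    qed
  qed
  moreover have "\<psi> ` {0..fst q} = {0..fst p}"
    using inj img by (metis \<psi>_def inv_into_image_cancel order_refl)
  moreover have "\<forall>r\<in>{0..fst q}. snd p (\<psi> r) = snd q r"
    using inv val by metis
  ultimately show ?thesis unfolding reparam_def by blast
qed

lemma reparam_trans:
  assumes "reparam p q" "reparam q r"
  shows "reparam p r"
proof -
  obtain \<phi> where \<phi>: "strict_mono_on {0..fst p} \<phi>" "\<phi> ` {0..fst p} = {0..fst q}"
    "\<And>s. s \<in> {0..fst p} \<Longrightarrow> snd q (\<phi> s) = snd p s"
    using assms by (auto simp: reparam_def)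
  obtain \<psi> where \<psi>: "strict_mono_on {0..fst q} \<psi>" "\<psi> ` {0..fst q} = {0..fst r}"
    "\<And>s. s \<in> {0..fst q} \<Longrightarrow> snd r (\<psi> s) = snd q s"
    using assms by (auto simp: reparam_def)
  have in_q: "\<phi> s \<in> {0..fst q}" if "s \<in> {0..fst p}" for s
    using \<phi>(2) that by blast
  show ?thesis unfolding reparam_def
  proof (intro exI[of _ "\<psi> \<circ> \<phi>"] conjI)
    show "strict_mono_on {0..fst p} (\<psi> \<circ> \<phi>)"
      using in_q \<phi>(1) \<psi>(1) by (simp add: strict_mono_on_def)
    show "(\<psi> \<circ> \<phi>) ` {0..fst p} = {0..fst r}"
      using \<phi>(2) \<psi>(2) by (simp only: image_comp[symmetric])
  qed (use in_q \<phi>(3) \<psi>(3) in auto)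
qed

lemma mclass_eq_iff: "mclass p = mclass q \<longleftrightarrow> reparam p q"
proof
  assume "mclass p = mclass q"
  moreover have "q \<in> mclass q" by (simp add: mclass_def reparam_refl)
  ultimately show "reparam p q" unfolding mclass_def by blast
next
  assume "reparam p q"
  then show "mclass p = mclass q"
    unfolding mclass_def by (intro Collect_cong) (metis reparam_sym reparam_trans)
qed

text \<open>The reparametrizations of the factors are run one after the other. At the junction the product
  takes the value of the first factor, so no later time may be moved to the junction; this holds
  because the reparametrization of the second factor is positive at positive times.\<close>

lemma reparam_mmult:
  assumes pp: "reparam p p'" and qq: "reparam q q'"
    and len: "0 \<le> fst p" "0 \<le> fst q" "0 \<le> fst p'" "0 \<le> fst q'"
  shows "reparam (p \<star> q) (p' \<star> q')"
proof -
  obtain \<phi> where \<phi>: "strict_mono_on {0..fst p} \<phi>" "\<phi> ` {0..fst p} = {0..fst p'}"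
    "\<And>s. s \<in> {0..fst p} \<Longrightarrow> snd p' (\<phi> s) = snd p s"
    using pp by (auto simp: reparam_def)
  obtain \<psi> where \<psi>: "strict_mono_on {0..fst q} \<psi>" "\<psi> ` {0..fst q} = {0..fst q'}"
    "\<And>s. s \<in> {0..fst q} \<Longrightarrow> snd q' (\<psi> s) = snd q s"
    using qq by (auto simp: reparam_def)
  have in_p: "\<phi> s \<in> {0..fst p'}" if "s \<in> {0..fst p}" for s using \<phi>(2) that by blast
  have in_q: "\<psi> s \<in> {0..fst q'}" if "s \<in> {0..fst q}" for s using \<psi>(2) that by blast
  have pos: "0 < \<psi> s" if "s \<in> {0..fst q}" "0 < s" for s
  proof -
    have "0 \<le> \<psi> 0" "\<psi> 0 < \<psi> s"
      using in_q[of 0] that \<psi>(1) by (auto simp: strict_mono_on_def)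
    then show ?thesis by simp
  qed
  define \<chi> where "\<chi> s = (if s \<le> fst p then \<phi> s else fst p' + \<psi> (s - fst p))" for s
  have "strict_mono_on {0..fst p + fst q} \<chi>"
  proof (rule strict_mono_onI)
    fix r s assume rs: "r \<in> {0..fst p + fst q}" "s \<in> {0..fst p + fst q}" "r < s"
    consider "s \<le> fst p" | "r \<le> fst p" "fst p < s" | "fst p < r" by linarith
    then show "\<chi> r < \<chi> s"
    proof cases
      case 1 then show ?thesis using rs strict_mono_onD[OF \<phi>(1), of r s] by (auto simp: \<chi>_def)
    next
      case 2 then show ?thesis using rs in_p[of r] pos[of "s - fst p"] by (auto simp: \<chi>_def)
    next
      case 3
      then show ?thesis
        using rs strict_mono_onD[OF \<psi>(1), of "r - fst p" "s - fst p"] by (auto simp: \<chi>_def)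
    qed
  qed
  moreover have "\<chi> ` {0..fst p + fst q} = {0..fst p' + fst q'}"
  proof (intro equalityI subsetI)
    fix y assume "y \<in> \<chi> ` {0..fst p + fst q}"
    then obtain s where s: "s \<in> {0..fst p + fst q}" "y = \<chi> s" by blast
    then show "y \<in> {0..fst p' + fst q'}"
      using in_p[of s] in_q[of "s - fst p"] len by (auto simp: \<chi>_def)
  next
    fix y assume y: "y \<in> {0..fst p' + fst q'}"
    show "y \<in> \<chi> ` {0..fst p + fst q}"
    proof (cases "y \<le> fst p'")
      case True
      with y \<phi>(2) have "y \<in> \<phi> ` {0..fst p}" by simp
      then obtain s where "s \<in> {0..fst p}" "y = \<phi> s" by blast
      then show ?thesis using len by (intro image_eqI[of _ _ s]) (auto simp: \<chi>_def)
    next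
      case False
      with y \<psi>(2) have "y - fst p' \<in> \<psi> ` {0..fst q}" by simp
      then obtain s where s: "s \<in> {0..fst q}" "y - fst p' = \<psi> s" by blast
      show ?thesis
      \<comment> \<open>The time 0 of the second factor is not available as preimage, because there the product
        follows the first factor.\<close>
      proof (cases "s = 0")
        case True
        have "\<psi> 0 = 0"
        proof -
          have "0 \<in> \<psi> ` {0..fst q}" using \<psi>(2) len by simp
          then show ?thesis using pos in_q by force
        qed
        with s True False show ?thesis by simp
      next
        case False
        with s show ?thesis using len by (intro image_eqI[of _ _ "s + fst p"]) (auto simp: \<chi>_def)
      qed
    qed
  qed
  moreover have "snd (p' \<star> q') (\<chi> s) = snd (p \<star> q) s" if "s \<in> {0..fst p + fst q}" for s
    using that in_p[of s] \<phi>(3)[of s] \<psi>(3)[of "s - fst p"] pos[of "s - fst p"]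
    by (auto simp: mmult_def \<chi>_def)
  ultimately show ?thesis
    unfolding reparam_def by (intro exI[of _ \<chi>]) (auto simp: mmult_def)
qed

lemma mmult_assoc: "0 \<le> fst q \<Longrightarrow> (p \<star> q) \<star> r = p \<star> q \<star> r"
  by (auto simp: mmult_def fun_eq_iff algebra_simps)

text \<open>An increasing bijection that matches the integers of two intervals is the identity on them: if it
  fixes \<open>k\<close>, then it sends \<open>k + 1\<close> to an integer above
  \<open>k\<close>, while \<open>k + 1\<close> itself is the image of an integer after
  \<open>k\<close>.\<close>

lemma increasing_bijection_fixes_integers:
  fixes \<phi> :: "real \<Rightarrow> real"
  assumes mono: "strict_mono_on {0..real n} \<phi>" and img: "\<phi> ` {0..real n} = {0..real m}"
    and int: "\<And>r. r \<in> {0..real n} \<Longrightarrow> \<phi> r \<in> \<int> \<longleftrightarrow> r \<in> \<int>"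
  shows "n = m" "\<And>k. k \<le> n \<Longrightarrow> \<phi> (real k) = real k"
proof -
  have range: "\<phi> r \<in> {0..real m}" if "r \<in> {0..real n}" for r using img that by blast
  have le: "\<phi> r \<le> \<phi> s" if "r \<le> s" "r \<in> {0..real n}" "s \<in> {0..real n}" for r s
    using that strict_mono_onD[OF mono that(2,3)] by (cases "r = s") auto
  have reflects: "r < s" if "\<phi> r < \<phi> s" "r \<in> {0..real n}" "s \<in> {0..real n}" for r s
    using le[of s r] that by linarith
  have step: "a + 1 \<le> b" if "a < b" "a \<in> \<int>" "b \<in> \<int>" for a b :: real
  proof -
    obtain i where i: "a = of_int i" using \<open>a \<in> \<int>\<close> by (rule Ints_cases)
    obtain j where j: "b = of_int j" using \<open>b \<in> \<int>\<close> by (rule Ints_cases)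
    have "i + 1 \<le> j" using \<open>a < b\<close> i j by simp
    then have "real_of_int (i + 1) \<le> real_of_int j" by (simp only: of_int_le_iff)
    with i j show ?thesis by simp
  qed
  show fixed: "\<phi> (real k) = real k" if "k \<le> n" for k
    using that
  proof (induction k)
    case 0
    have "0 \<in> \<phi> ` {0..real n}" unfolding img by simp
    then obtain r where "r \<in> {0..real n}" "\<phi> r = 0" by auto
    then show ?case using le[of 0 r] range[of 0] by simp
  next
    case (Suc k)
    have k: "real k \<in> {0..real n}" "real (Suc k) \<in> {0..real n}" using Suc.prems by auto
    have "\<phi> (real k) < \<phi> (real (Suc k))"
      using mono k by (auto simp: strict_mono_on_def)
    moreover have "\<phi> (real k) = real k" using Suc by simp
    moreover have "\<phi> (real (Suc k)) \<in> \<int>" using int[OF k(2)] by simp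
    ultimately have ge: "real (Suc k) \<le> \<phi> (real (Suc k))"
      using step[of "\<phi> (real k)" "\<phi> (real (Suc k))"] by simp
    then have "real (Suc k) \<in> {0..real m}" using range[OF k(2)] by auto
    then have "real (Suc k) \<in> \<phi> ` {0..real n}" by (simp only: img)
    then obtain r where r: "r \<in> {0..real n}" "\<phi> r = real (Suc k)" by (metis imageE)
    then have "real k < r" "r \<in> \<int>"
      using reflects[of "real k" r] k Suc int[of r] by simp_all
    then have "real (Suc k) \<le> r" using step[of "real k" r] by simp
    with le[of "real (Suc k)" r] r k ge show ?case by simp
  qed
  have "real m \<in> \<phi> ` {0..real n}" unfolding img by simp
  then obtain r where "r \<in> {0..real n}" "\<phi> r = real m" by (metis imageE)
  then have "real m \<le> \<phi> (real n)" using le[of r "real n"] by simp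
  with fixed[of n] range[of "real n"] show "n = m" by simp
qed

section \<open>Canonical representatives of the points of a directed 2-complex\<close>

text \<open>Every point of the realization of a complex is a vertex, an interior point of an arc or an interior
  point of a square, and in only one way. The following functions compute this representative; that
  they are constant on the glued classes is what separates points of the realization.\<close>

fun canon_skeleton :: "('v, 'e, 'f) dir_complex \<Rightarrow> ('v, 'e, 'f) prepoint \<Rightarrow> ('v, 'e, 'f) prepoint" where
  "canon_skeleton K (Arc_Point e s) =
    (if s = 0 then Vertex (tail (dgraph K) e) else if s = 1 then Vertex (head (dgraph K) e)
     else Arc_Point e s)"
| "canon_skeleton K x = x"

fun canon :: "('v, 'e, 'f) dir_complex \<Rightarrow> ('v, 'e, 'f) prepoint \<Rightarrow> ('v, 'e, 'f) prepoint" where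
  "canon K (Cell_Point f s t) =
    (if s = 0 then Vertex (cell_init K f) else if s = 1 then Vertex (cell_term K f)
     else if t = 0 then canon_skeleton K (prewalk_at (dgraph K) (ctop K f) s)
     else if t = 1 then canon_skeleton K (prewalk_at (dgraph K) (cbot K f) s)
     else Cell_Point f s t)"
| "canon K x = canon_skeleton K x"

context directed_2_complex
begin

lemma paths1_Nil: "(v, []) \<in> paths1 (dgraph K) \<longleftrightarrow> v \<in> verts (dgraph K)"
proof -
  interpret wf_digraph "dgraph K" by (rule wf_graph)
  show ?thesis by (simp add: paths1_def path1_init_def path1_term_def awalk_Nil_iff)
qed

lemma paths1_Cons:
  "(v, e # es) \<in> paths1 (dgraph K) \<longleftrightarrow>
    e \<in> arcs (dgraph K) \<and> v = tail (dgraph K) e \<and> (head (dgraph K) e, es) \<in> paths1 (dgraph K)"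
proof -
  interpret wf_digraph "dgraph K" by (rule wf_graph)
  show ?thesis by (auto simp: paths1_def path1_init_def path1_term_def awalk_Cons_iff)
qed

lemma path1_term_simps:
  "path1_term (dgraph K) (v, []) = v"
  "path1_term (dgraph K) (v, e # es) = path1_term (dgraph K) (head (dgraph K) e, es)"
  by (simp_all add: path1_term_def pre_digraph.awalk_verts.simps pre_digraph.awalk_verts_non_Nil)

lemma neg_cells_iff: "f \<in> neg_cells K \<longleftrightarrow> f \<in> cells K \<and> f \<notin> pos_cells K"
  using orient_union orient_disjoint by blast

lemma pos_cellsD: "f \<in> pos_cells K \<Longrightarrow> f \<in> cells K"
  using orient_union by blast

lemma cinv_pos_iff:
  assumes f: "f \<in> cells K"
  shows "cinv K f \<in> pos_cells K \<longleftrightarrow> f \<notin> pos_cells K"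
proof (cases "f \<in> pos_cells K")
  case True
  then have "cinv K f \<in> neg_cells K" by (simp add: neg_cells_def)
  with True show ?thesis by (simp add: neg_cells_iff)
next
  case False
  with f have "f \<in> neg_cells K" by (simp add: neg_cells_iff)
  then obtain g where "g \<in> pos_cells K" "f = cinv K g" by (auto simp: neg_cells_def)
  with False show ?thesis by (simp add: inv_inv pos_cellsD)
qed

lemma cell_init_inv: "f \<in> cells K \<Longrightarrow> cell_init K (cinv K f) = cell_init K f"
  by (simp add: cell_init_def top_inv same_init)

lemma cell_term_inv: "f \<in> cells K \<Longrightarrow> cell_term K (cinv K f) = cell_term K f"
  by (simp add: cell_term_def top_inv same_term)

text \<open>Before gluing, a walk along arcs begins and ends either at a vertex (if it is empty) or at an
  endpoint of an arc. These two facts serve both to compute canonical representatives and to compute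
  the ends of paths in the realization.\<close>

lemma prewalk_start:
  assumes "u \<in> paths1 (dgraph K)"
  shows "snd (prewalk (dgraph K) u) 0 = (Vertex (path1_init u) :: ('v, 'e, 'f) prepoint) \<or>
    (\<exists>e \<in> arcs (dgraph K). snd (prewalk (dgraph K) u) 0 = (Arc_Point e 0 :: ('v, 'e, 'f) prepoint) \<and>
       tail (dgraph K) e = path1_init u)"
proof -
  obtain v es where u: "u = (v, es)" by fastforce
  show ?thesis using assms unfolding u
    by (cases es) (auto simp: paths1_Cons path1_init_def mmult_def)
qed

lemma prewalk_end:
  assumes "u \<in> paths1 (dgraph K)"
  shows "snd (prewalk (dgraph K) u) (real (length (snd u))) =
      (Vertex (path1_term (dgraph K) u) :: ('v, 'e, 'f) prepoint) \<or>
    (\<exists>e \<in> arcs (dgraph K). snd (prewalk (dgraph K) u) (real (length (snd u))) =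
       (Arc_Point e 1 :: ('v, 'e, 'f) prepoint) \<and> head (dgraph K) e = path1_term (dgraph K) u)"
proof -
  have "snd (prewalk (dgraph K) (v, es)) (real (length es)) =
      (Vertex (path1_term (dgraph K) (v, es)) :: ('v, 'e, 'f) prepoint) \<or>
    (\<exists>e \<in> arcs (dgraph K). snd (prewalk (dgraph K) (v, es)) (real (length es)) =
       (Arc_Point e 1 :: ('v, 'e, 'f) prepoint) \<and> head (dgraph K) e = path1_term (dgraph K) (v, es))"
    if "(v, es) \<in> paths1 (dgraph K)" for v es
    using that
  proof (induction es arbitrary: v)
    case (Cons e es)
    then show ?case
      by (cases es) (auto simp: paths1_Cons path1_term_simps mmult_def)
  qed (simp add: path1_term_simps)
  then show ?thesis using assms by (cases u) auto
qed

lemma prewalk_not_cell: "snd (prewalk G u) s \<noteq> Cell_Point f a b"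
  by (induction G u arbitrary: s rule: prewalk.induct) (auto simp: mmult_def)

lemma canon_prewalk_at: "canon K (prewalk_at (dgraph K) u s) = canon_skeleton K (prewalk_at (dgraph K) u s)"
  by (cases "prewalk_at (dgraph K) u s :: ('v, 'e, 'f) prepoint")
    (simp_all add: prewalk_at_def prewalk_not_cell)

lemma canon_prewalk_ends:
  assumes "u \<in> paths1 (dgraph K)"
  shows "canon_skeleton K (prewalk_at (dgraph K) u 0) = Vertex (path1_init u)"
    "canon_skeleton K (prewalk_at (dgraph K) u 1) = Vertex (path1_term (dgraph K) u)"
proof -
  show "canon_skeleton K (prewalk_at (dgraph K) u 0) = Vertex (path1_init u)"
    using prewalk_start[OF assms] by (elim disjE bexE conjE) (simp_all add: prewalk_at_def)
  show "canon_skeleton K (prewalk_at (dgraph K) u 1) = Vertex (path1_term (dgraph K) u)"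
    using prewalk_end[OF assms] by (elim disjE bexE conjE) (simp_all add: prewalk_at_def fst_prewalk)
qed

text \<open>The only overlap of the gluing rules is at the corners of a square, where the sides that are
  collapsed to vertices meet the top and the bottom path; there the rules agree because these paths
  run from the initial to the terminal vertex of the cell.\<close>

lemma canon_glue: "cell_glue K x y \<Longrightarrow> canon K x = canon K y"
proof (induction rule: cell_glue.induct)
  case (3 f s)
  have f: "f \<in> cells K" using 3(1) by (rule pos_cellsD)
  show ?case using canon_prewalk_ends[of "ctop K f"] top_path[OF f]
    by (simp add: canon_prewalk_at cell_init_def cell_term_def)
next
  case (4 f s)
  have f: "f \<in> cells K" using 4(1) by (rule pos_cellsD)
  show ?case using canon_prewalk_ends[of "cbot K f"] bot_path[OF f] same_init[OF f] same_term[OF f]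
    by (simp add: canon_prewalk_at cell_init_def cell_term_def)
qed simp_all

lemma canon_cong:
  assumes "cpoint K x = cpoint K y"
  shows "canon K x = canon K y"
proof -
  have "y \<in> cpoint K x" unfolding assms by (simp add: cpoint_def)
  then have "equivclp (cell_glue K) x y" by (simp add: cpoint_def)
  then show ?thesis
    by (induction rule: equivclp_induct) (auto dest: canon_glue)
qed

lemma Vertex_cpoint_inject: "cpoint K (Vertex v) = cpoint K (Vertex w) \<Longrightarrow> v = w"
  by (drule canon_cong) simp

lemma cpoint_Arc_ends:
  assumes "e \<in> arcs (dgraph K)"
  shows "cpoint K (Arc_Point e 0) = cpoint K (Vertex (tail (dgraph K) e))"
    "cpoint K (Arc_Point e 1) = cpoint K (Vertex (head (dgraph K) e))"
  using assms by (auto intro!: cpoint_glue cell_glue.intros)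

lemma walk_path_start:
  assumes "u \<in> paths1 (dgraph K)"
  shows "mstart (walk_path K u) = cpoint K (Vertex (path1_init u))"
  using prewalk_start[OF assms]
proof (elim disjE bexE conjE)
  fix e
  assume "e \<in> arcs (dgraph K)" "tail (dgraph K) e = path1_init u"
    "snd (prewalk (dgraph K) u) 0 = (Arc_Point e 0 :: ('v, 'e, 'f) prepoint)"
  then show ?thesis using cpoint_Arc_ends(1)[of e] by (simp add: mstart_def walk_path_def)
qed (simp add: mstart_def walk_path_def)

lemma walk_path_end:
  assumes "u \<in> paths1 (dgraph K)"
  shows "mend (walk_path K u) = cpoint K (Vertex (path1_term (dgraph K) u))"
  using prewalk_end[OF assms]
proof (elim disjE bexE conjE)
  fix e
  assume "e \<in> arcs (dgraph K)" "head (dgraph K) e = path1_term (dgraph K) u"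
    "snd (prewalk (dgraph K) u) (real (length (snd u))) = (Arc_Point e 1 :: ('v, 'e, 'f) prepoint)"
  then show ?thesis using cpoint_Arc_ends(2)[of e] by (simp add: mend_def walk_path_def fst_prewalk)
qed (simp add: mend_def walk_path_def fst_prewalk)

lemma cell_path_ends_vertex:
  assumes f: "f \<in> cells K" and t: "t \<in> {0..1}"
  shows "snd (cell_path K f t) 0 = cpoint K (Vertex (cell_init K f))" (is ?start)
    and "snd (cell_path K f t) 1 = cpoint K (Vertex (cell_term K f))" (is ?end)
proof -
  have "?start \<and> ?end"
  proof (cases "f \<in> pos_cells K")
    case True
    with t show ?thesis
      by (auto simp: cell_path_def intro!: cpoint_glue cell_glue.intros)
  next
    case False
    with f have "cinv K f \<in> pos_cells K" by (simp add: cinv_pos_iff)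
    with t False cell_glue.intros(5,6)[of "cinv K f" K "1 - t"] show ?thesis
      by (auto simp: cell_path_def cell_init_inv[OF f] cell_term_inv[OF f] intro!: cpoint_glue)
  qed
  then show ?start ?end by auto
qed

lemma cell_path_inv:
  assumes "f \<in> cells K"
  shows "cell_path K (cinv K f) (1 - t) = cell_path K f t"
  by (cases "f \<in> pos_cells K") (simp_all add: cell_path_def cinv_pos_iff[OF assms] inv_inv[OF assms])

end

section \<open>Words and the paths along them\<close>

text \<open>A letter stands for a piece of a positive path that meets the vertices only in its ends: an arc or a
  path \<open>f\<^sub>t\<close>. To make the letter of such a path unique, only negative cells and
  \<open>0 < t < 1\<close> are admitted.\<close>

datatype ('e, 'f) letter = Arc_Letter 'e | Cell_Letter 'f real

fun is_letter :: "('v, 'e, 'f) dir_complex \<Rightarrow> ('e, 'f) letter \<Rightarrow> bool" where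
  "is_letter K (Arc_Letter e) \<longleftrightarrow> e \<in> arcs (dgraph K)"
| "is_letter K (Cell_Letter f t) \<longleftrightarrow> f \<in> neg_cells K \<and> t \<in> {0<..<1}"

fun letter_init :: "('v, 'e, 'f) dir_complex \<Rightarrow> ('e, 'f) letter \<Rightarrow> 'v" where
  "letter_init K (Arc_Letter e) = tail (dgraph K) e"
| "letter_init K (Cell_Letter f t) = cell_init K f"

fun letter_term :: "('v, 'e, 'f) dir_complex \<Rightarrow> ('e, 'f) letter \<Rightarrow> 'v" where
  "letter_term K (Arc_Letter e) = head (dgraph K) e"
| "letter_term K (Cell_Letter f t) = cell_term K f"

fun letter_path :: "('v, 'e, 'f) dir_complex \<Rightarrow> ('e, 'f) letter \<Rightarrow> ('v, 'e, 'f) point mpath" where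
  "letter_path K (Arc_Letter e) = (1, \<lambda>s. cpoint K (Arc_Point e s))"
| "letter_path K (Cell_Letter f t) = cell_path K f t"

text \<open>The initial vertex is kept in addition to the letters because an empty word would otherwise
  not determine its path.\<close>

fun is_word :: "('v, 'e, 'f) dir_complex \<Rightarrow> 'v \<Rightarrow> ('e, 'f) letter list \<Rightarrow> 'v \<Rightarrow> bool" where
  "is_word K v [] w \<longleftrightarrow> v \<in> verts (dgraph K) \<and> w = v"
| "is_word K v (l # ls) w \<longleftrightarrow> is_letter K l \<and> letter_init K l = v \<and> is_word K (letter_term K l) ls w"

text \<open>Each letter takes one unit of time, so the letter boundaries are the integer times.\<close>

fun word_path :: "('v, 'e, 'f) dir_complex \<Rightarrow> 'v \<Rightarrow> ('e, 'f) letter list \<Rightarrow> ('v, 'e, 'f) point mpath" where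
  "word_path K v [] = (0, \<lambda>_. cpoint K (Vertex v))"
| "word_path K v (l # ls) = letter_path K l \<star> word_path K (letter_term K l) ls"

lemma fst_letter_path: "fst (letter_path K l) = 1"
  by (cases l) (simp_all add: cell_path_def)

lemma fst_word_path: "fst (word_path K v ls) = real (length ls)"
  by (induction ls arbitrary: v) (simp_all add: mmult_def fst_letter_path)

lemma word_path_nth:
  "j < length ls \<Longrightarrow> 0 < s \<Longrightarrow> s \<le> 1 \<Longrightarrow>
    snd (word_path K v ls) (real j + s) = snd (letter_path K (ls ! j)) s"
proof (induction ls arbitrary: v j)
  case (Cons l ls)
  then show ?case by (cases j) (simp_all add: mmult_def fst_letter_path add.commute)
qed simp

context directed_2_complex
begin

lemma letter_path_ends:
  assumes "is_letter K l"
  shows "snd (letter_path K l) 0 = cpoint K (Vertex (letter_init K l))"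
    "snd (letter_path K l) 1 = cpoint K (Vertex (letter_term K l))"
  using assms by (cases l; simp add: cpoint_Arc_ends cell_path_ends_vertex neg_cells_iff)+

lemma word_path_start:
  assumes "is_word K v ls w"
  shows "mstart (word_path K v ls) = cpoint K (Vertex v)"
  using assms by (cases ls) (auto simp: mstart_def mmult_def fst_letter_path letter_path_ends)

lemma is_word_append:
  assumes "is_word K v ls w" "is_word K w ls' x"
  shows "is_word K v (ls @ ls') x"
  using assms by (induction ls arbitrary: v) auto

lemma word_path_append:
  assumes "is_word K v ls w" "is_word K w ls' x"
  shows "reparam (word_path K v ls \<star> word_path K w ls') (word_path K v (ls @ ls'))"
  using assms
proof (induction ls arbitrary: v)
  case Nil
  then show ?case using word_path_start[OF Nil(2)]
    by (intro reparam_same) (auto simp: mmult_def mstart_def)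
next
  case (Cons l ls)
  then have "reparam (word_path K (letter_term K l) ls \<star> word_path K w ls')
      (word_path K (letter_term K l) (ls @ ls'))"
    by simp
  then have "reparam (letter_path K l \<star> word_path K (letter_term K l) ls \<star> word_path K w ls')
      (word_path K v ((l # ls) @ ls'))"
    by (simp add: reparam_mmult[OF reparam_refl] fst_letter_path fst_word_path mmult_def[of _ "word_path K w ls'"])
  then show ?case by (simp add: mmult_assoc fst_word_path)
qed

lemma is_letter_ends_in_verts:
  "is_letter K l \<Longrightarrow> letter_init K l \<in> verts (dgraph K) \<and> letter_term K l \<in> verts (dgraph K)"
proof -
  interpret wf_digraph "dgraph K" by (rule wf_graph)
  assume l: "is_letter K l"
  show ?thesis
  proof (cases l)
    case (Cell_Letter f t)
    with l have "ctop K f \<in> paths1 (dgraph K)" using top_path by (simp add: neg_cells_iff)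
    then have "awalk (cell_init K f) (snd (ctop K f)) (cell_term K f)"
      by (simp add: paths1_def cell_init_def cell_term_def)
    then show ?thesis using Cell_Letter by auto
  qed (use l in simp)
qed

lemma is_word_singleton:
  "is_letter K l \<Longrightarrow> is_word K (letter_init K l) [l] (letter_term K l)"
  by (simp add: is_letter_ends_in_verts)

lemma word_path_singleton:
  assumes "is_letter K l"
  shows "reparam (letter_path K l) (word_path K v [l])"
  by (rule reparam_same) (simp_all add: mmult_def fst_letter_path)

lemma letter_point_not_vertex:
  assumes "is_letter K l" "0 < s" "s < 1"
  shows "snd (letter_path K l) s \<noteq> cpoint K (Vertex v)"
proof
  assume eq: "snd (letter_path K l) s = cpoint K (Vertex v)"
  show False
  proof (cases l)
    case (Arc_Letter e)
    with eq assms show False by (auto dest!: canon_cong)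
  next
    case (Cell_Letter f t)
    with eq assms show False
      by (auto simp: cell_path_def neg_cells_iff dest!: canon_cong)
  qed
qed

lemma letter_point_inject:
  assumes l: "is_letter K l" "0 < s" "s < 1" and l': "is_letter K l'" "0 < s'" "s' < 1"
    and eq: "snd (letter_path K l) s = snd (letter_path K l') s'"
  shows "l = l'"
proof -
  have inj: "f = g" if "cinv K f = cinv K g" "f \<in> cells K" "g \<in> cells K" for f g
    using inv_inv that by metis
  show ?thesis
    using assms by (cases l; cases l')
      (auto simp: cell_path_def neg_cells_iff dest!: canon_cong intro: inj)
qed

lemma is_word_nth: "is_word K v ls w \<Longrightarrow> j < length ls \<Longrightarrow> is_letter K (ls ! j)"
  by (induction ls arbitrary: v j) (auto simp: nth_Cons split: nat.splits)

text \<open>A letter meets the vertices only in its ends. As being at a vertex is a property of a point of the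
  realization, a reparametrization must respect the vertex times.\<close>

lemma word_path_vertex_times:
  assumes w: "is_word K v ls w" and r: "0 \<le> r" "r \<le> real (length ls)"
  shows "(\<exists>x. snd (word_path K v ls) r = cpoint K (Vertex x)) \<longleftrightarrow> r \<in> \<int>"
proof (cases "r = 0")
  case True
  then show ?thesis using word_path_start[OF w] by (auto simp: mstart_def)
next
  case False
  \<comment> \<open>An integer time is counted as the end of the preceding letter, as in the product of paths.\<close>
  define j where "j = nat (\<lceil>r\<rceil> - 1)"
  define s where "s = r - real j"
  have "real j = of_int (\<lceil>r\<rceil> - 1)" using False r by (simp add: j_def)
  then have s: "0 < s" "s \<le> 1" "r = real j + s"
    unfolding s_def by linarith+
  then have j: "j < length ls" using r by linarith
  have l: "is_letter K (ls ! j)" using is_word_nth[OF w j] .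
  have val: "snd (word_path K v ls) r = snd (letter_path K (ls ! j)) s"
    using word_path_nth[OF j s(1,2)] s(3) by simp
  show ?thesis
  proof (cases "s = 1")
    case True
    with val letter_path_ends(2)[OF l] s(3) show ?thesis by auto
  next
    case False
    with s have lt: "s < 1" by simp
    have "s \<notin> \<int>"
    proof
      assume "s \<in> \<int>"
      then obtain i where "s = of_int i" by (rule Ints_cases)
      with s(1) lt show False by simp
    qed
    then have "r \<notin> \<int>" using s(3) Ints_diff[of r "real j"] by auto
    then show ?thesis using val letter_point_not_vertex[OF l s(1) lt] by auto
  qed
qed

text \<open>A reparametrization sends vertex times to vertex times, hence fixes the integers; so it maps each
  open unit interval onto itself, and the point reached at the middle of the interval tells the letter.\<close>

lemma word_path_inject:
  assumes w: "is_word K v ls x" and w': "is_word K v' ls' x'"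
    and rep: "reparam (word_path K v ls) (word_path K v' ls')"
  shows "v = v'" "ls = ls'"
proof -
  obtain \<phi> where mono: "strict_mono_on {0..real (length ls)} \<phi>"
    and img: "\<phi> ` {0..real (length ls)} = {0..real (length ls')}"
    and val: "\<And>r. r \<in> {0..real (length ls)} \<Longrightarrow>
      snd (word_path K v' ls') (\<phi> r) = snd (word_path K v ls) r"
    using rep unfolding reparam_def fst_word_path by blast
  have range: "\<phi> r \<in> {0..real (length ls')}" if "r \<in> {0..real (length ls)}" for r
    using that img by blast
  have int: "\<phi> r \<in> \<int> \<longleftrightarrow> r \<in> \<int>" if "r \<in> {0..real (length ls)}" for r
    using word_path_vertex_times[OF w, of r] word_path_vertex_times[OF w', of "\<phi> r"]
      val[OF that] range[OF that] that by simp
  note len = increasing_bijection_fixes_integers(1)[OF mono img int]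
  note fixed = increasing_bijection_fixes_integers(2)[OF mono img int]
  have "cpoint K (Vertex v') = cpoint K (Vertex v)"
    using word_path_start[OF w] word_path_start[OF w'] val[of 0] fixed[of 0] by (simp add: mstart_def)
  then show "v = v'" by (metis Vertex_cpoint_inject)
  show "ls = ls'"
  proof (rule nth_equalityI[OF len])
    fix j assume j: "j < length ls"
    with len have j': "j < length ls'" by simp
    let ?r = "real j + 1 / 2"
    have r: "real j \<in> {0..real (length ls)}" "?r \<in> {0..real (length ls)}"
      "real (Suc j) \<in> {0..real (length ls)}"
      using j by auto
    have "\<phi> (real j) < \<phi> ?r" "\<phi> ?r < \<phi> (real (Suc j))"
      using strict_mono_onD[OF mono r(1,2)] strict_mono_onD[OF mono r(2,3)] by auto
    then have s: "0 < \<phi> ?r - real j" "\<phi> ?r - real j < 1"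
      using fixed[of j] fixed[of "Suc j"] j by auto
    have "snd (letter_path K (ls ! j)) (1 / 2) = snd (letter_path K (ls' ! j)) (\<phi> ?r - real j)"
      using val[OF r(2)] word_path_nth[OF j, of "1 / 2" K v]
        word_path_nth[OF j', of "\<phi> ?r - real j" K v'] s by simp
    then show "ls ! j = ls' ! j"
      using letter_point_inject[OF is_word_nth[OF w j] _ _ is_word_nth[OF w' j'] s, of "1 / 2"] by simp
  qed
qed

lemma walk_path_word: "walk_path K u = word_path K (fst u) (map Arc_Letter (snd u))"
proof -
  have "walk_path K (v, es) = word_path K v (map Arc_Letter es)" for v es
  proof (induction es arbitrary: v)
    case Nil
    show ?case by (simp add: walk_path_def)
  next
    case (Cons e es)
    show ?case unfolding list.map word_path.simps letter_term.simps Cons.IH[symmetric]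
      by (auto simp: walk_path_def mmult_def fun_eq_iff)
  qed
  then show ?thesis by (cases u) simp
qed

lemma is_word_path1:
  "u \<in> paths1 (dgraph K) \<Longrightarrow>
    is_word K (path1_init u) (map Arc_Letter (snd u)) (path1_term (dgraph K) u)"
proof -
  have "(v, es) \<in> paths1 (dgraph K) \<Longrightarrow>
    is_word K v (map Arc_Letter es) (path1_term (dgraph K) (v, es))" for v es
    by (induction es arbitrary: v) (auto simp: paths1_Nil paths1_Cons path1_term_simps)
  then show "u \<in> paths1 (dgraph K) \<Longrightarrow> ?thesis"
    by (cases u) (simp add: path1_init_def)
qed

end

section \<open>Thin diagrams and their words\<close>

text \<open>The word of \<open>f\<^sub>t\<close> for any cell, using \<open>f\<^sub>0 = \<lceil>f\<rceil>\<close>,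
  \<open>f\<^sub>1 = \<lfloor>f\<rfloor>\<close> and
  \<open>f\<^sub>t = (f\<^sup>-\<^sup>1)\<^sub>1\<^sub>-\<^sub>t\<close>.\<close>

definition cell_letters :: "('v, 'e, 'f) dir_complex \<Rightarrow> 'f \<Rightarrow> real \<Rightarrow> ('e, 'f) letter list" where
  "cell_letters K f t =
    (if t = 0 then map Arc_Letter (snd (ctop K f))
     else if t = 1 then map Arc_Letter (snd (cbot K f))
     else if f \<in> pos_cells K then [Cell_Letter (cinv K f) (1 - t)]
     else [Cell_Letter f t])"

text \<open>The recursion follows the cells only, so that the 1-path before the first cell is treated alike
  whether or not a cell follows.\<close>

fun thin_letters ::
  "('v, 'e, 'f) dir_complex \<Rightarrow> ('v, 'e) path1 list \<Rightarrow> 'f list \<Rightarrow> real list \<Rightarrow> ('e, 'f) letter list" where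
  "thin_letters K us [] ts = map Arc_Letter (snd (hd us))"
| "thin_letters K us (f # fs) ts =
    map Arc_Letter (snd (hd us)) @ cell_letters K f (hd ts) @ thin_letters K (tl us) fs (tl ts)"

text \<open>Thin diagrams with one coordinate per cell, built from the right. The cells are taken from
  \<open>A\<close> and the coordinates from \<open>T\<close>: negative cells with
  \<open>T = {0..1}\<close> give the points of the cubes, with \<open>T = {0<..<1}\<close> the normal
  forms. This description replaces the conditions on list indices by rule induction.\<close>

inductive labelled_thin ::
  "('v, 'e, 'f) dir_complex \<Rightarrow> 'f set \<Rightarrow> real set \<Rightarrow>
    ('v, 'e) path1 list \<Rightarrow> 'f list \<Rightarrow> real list \<Rightarrow> bool" for K A T where
  path: "u \<in> paths1 (dgraph K) \<Longrightarrow> labelled_thin K A T [u] [] []"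
| cell: "\<lbrakk>labelled_thin K A T us fs ts; u \<in> paths1 (dgraph K); f \<in> A; t \<in> T;
     path1_term (dgraph K) u = cell_init K f; cell_term K f = path1_init (hd us)\<rbrakk> \<Longrightarrow>
    labelled_thin K A T (u # us) (f # fs) (t # ts)"

lemma thin_diagrams_Nil:
  "(us, []) \<in> thin_diagrams K A \<longleftrightarrow> (\<exists>u \<in> paths1 (dgraph K). us = [u])"
  by (cases us) (auto simp: thin_diagrams_def)

lemma thin_diagrams_Cons:
  "(us, f # fs) \<in> thin_diagrams K A \<longleftrightarrow>
    (\<exists>u us'. us = u # us' \<and> u \<in> paths1 (dgraph K) \<and> f \<in> A \<and> path1_term (dgraph K) u = cell_init K f \<and>
       cell_term K f = path1_init (hd us') \<and> (us', fs) \<in> thin_diagrams K A)"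
proof (cases us)
  case (Cons u us')
  have split: "{1..length (f # fs)} = insert 1 (Suc ` {1..length fs})"
    by (simp add: image_Suc_atLeastAtMost atLeastAtMost_insertL)
  show ?thesis
    unfolding thin_diagrams_def split ball_simps mem_Collect_eq prod.case Cons
    by (cases us') (auto simp: nth_Cons')
qed (simp add: thin_diagrams_def)

lemma labelled_thin_iff:
  "labelled_thin K A T us fs ts \<longleftrightarrow>
    (us, fs) \<in> thin_diagrams K A \<and> length ts = length fs \<and> set ts \<subseteq> T"
proof
  assume "labelled_thin K A T us fs ts"
  then show "(us, fs) \<in> thin_diagrams K A \<and> length ts = length fs \<and> set ts \<subseteq> T"
    by induction (auto simp: thin_diagrams_Nil thin_diagrams_Cons)
next
  assume "(us, fs) \<in> thin_diagrams K A \<and> length ts = length fs \<and> set ts \<subseteq> T"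
  then show "labelled_thin K A T us fs ts"
  proof (induction fs arbitrary: us ts)
    case Nil
    then show ?case by (auto simp: thin_diagrams_Nil intro: labelled_thin.path)
  next
    case (Cons f fs)
    then show ?case
      by (cases ts) (auto simp: thin_diagrams_Cons intro!: labelled_thin.cell)
  qed
qed

lemma labelled_thin_mono:
  assumes "labelled_thin K A T us fs ts" "A \<subseteq> B" "T \<subseteq> U"
  shows "labelled_thin K B U us fs ts"
  using assms by induction (auto intro: labelled_thin.intros)

context directed_2_complex
begin

lemma cell_path_word:
  assumes f: "f \<in> cells K" and t: "t \<in> {0..1}"
  shows "is_word K (cell_init K f) (cell_letters K f t) (cell_term K f)"
    "reparam (cell_path K f t) (word_path K (cell_init K f) (cell_letters K f t))"
proof -
  consider "t = 0" | "t = 1" | "t \<in> {0<..<1}" using t by force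
  then have "is_word K (cell_init K f) (cell_letters K f t) (cell_term K f) \<and>
    reparam (cell_path K f t) (word_path K (cell_init K f) (cell_letters K f t))"
  proof cases
    case 1
    then show ?thesis
      using cell_path_ends(1)[OF f] top_path[OF f] is_word_path1[of "ctop K f"]
      by (simp add: cell_letters_def walk_path_word cell_init_def cell_term_def path1_init_def)
  next
    case 2
    then show ?thesis
      using cell_path_ends(2)[OF f] bot_path[OF f] is_word_path1[of "cbot K f"]
        same_init[OF f] same_term[OF f]
      by (simp add: cell_letters_def walk_path_word cell_init_def cell_term_def path1_init_def)
  next
    case 3
    define l :: "('e, 'f) letter"
      where "l = (if f \<in> pos_cells K then Cell_Letter (cinv K f) (1 - t) else Cell_Letter f t)"
    have l: "is_letter K l" "letter_init K l = cell_init K f" "letter_term K l = cell_term K f"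
      "letter_path K l = cell_path K f t"
      using f 3 by (auto simp: l_def neg_cells_iff cinv_pos_iff inv_cell cell_init_inv cell_term_inv
          cell_path_inv)
    have "cell_letters K f t = [l]" using 3 by (simp add: cell_letters_def l_def)
    then show ?thesis
      using is_word_singleton[OF l(1)] word_path_singleton[OF l(1)] l by metis
  qed
  then show "is_word K (cell_init K f) (cell_letters K f t) (cell_term K f)"
    "reparam (cell_path K f t) (word_path K (cell_init K f) (cell_letters K f t))" by auto
qed

lemma thin_letters_word:
  assumes "labelled_thin K (cells K) {0..1} us fs ts"
  shows "is_word K (path1_init (hd us)) (thin_letters K us fs ts) (path1_term (dgraph K) (last us))"
  using assms
proof induction
  case (path u)
  then show ?case by (simp add: is_word_path1)
next
  case (cell us fs ts u f t)
  have "us \<noteq> []" using cell.hyps(1) by cases auto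
  then show ?case
    using cell is_word_append[OF is_word_path1[OF cell.hyps(2)]
        is_word_append[OF cell_path_word(1)[of f t, folded cell.hyps(5)]]] by simp
qed

lemma fst_thin_path:
  "labelled_thin K A T us fs ts \<Longrightarrow> 0 \<le> fst (thin_path K (us, fs) ts)"
  by (induction rule: labelled_thin.induct)
    (simp_all add: mmult_def cell_path_def walk_path_def fst_prewalk)

lemma thin_path_start:
  assumes "labelled_thin K A T us fs ts"
  shows "mstart (thin_path K (us, fs) ts) = cpoint K (Vertex (path1_init (hd us)))"
  using assms
proof cases
  case (path u)
  then show ?thesis using walk_path_start by simp
next
  case (cell us fs ts u f t)
  then show ?thesis using walk_path_start[of u] by (simp add: mstart_def mmult_def walk_path_def fst_prewalk)
qed

lemma reparam_thin_path_word:
  assumes "labelled_thin K (cells K) {0..1} us fs ts"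
  shows "reparam (thin_path K (us, fs) ts)
    (word_path K (path1_init (hd us)) (thin_letters K us fs ts))"
  using assms
proof induction
  case (path u)
  then show ?case by (simp add: walk_path_word path1_init_def reparam_refl)
next
  case (cell us fs ts u f t)
  let ?w = "thin_letters K us fs ts"
  note cw = cell_path_word[OF cell.hyps(3,4)]
  have w: "is_word K (cell_term K f) ?w (path1_term (dgraph K) (last us))"
    using thin_letters_word[OF cell.hyps(1)] cell.hyps(6) by simp
  have "reparam (cell_path K f t \<star> thin_path K (us, fs) ts)
      (word_path K (cell_init K f) (cell_letters K f t) \<star> word_path K (cell_term K f) ?w)"
    using cell.IH cw(2) fst_thin_path[OF cell.hyps(1)] cell.hyps(6)
    by (intro reparam_mmult) (simp_all add: fst_word_path cell_path_def)
  then have 1: "reparam (cell_path K f t \<star> thin_path K (us, fs) ts)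
      (word_path K (cell_init K f) (cell_letters K f t @ ?w))"
    using word_path_append[OF cw(1) w] by (rule reparam_trans)
  have "reparam (walk_path K u \<star> cell_path K f t \<star> thin_path K (us, fs) ts)
      (word_path K (path1_init u) (map Arc_Letter (snd u)) \<star>
       word_path K (cell_init K f) (cell_letters K f t @ ?w))"
    using fst_thin_path[OF cell.hyps(1)] 1
    by (intro reparam_mmult)
      (simp_all add: walk_path_word path1_init_def reparam_refl fst_word_path, simp add: mmult_def cell_path_def)
  then show ?case
    using word_path_append[OF is_word_path1[OF cell.hyps(2), unfolded cell.hyps(5)]
        is_word_append[OF cw(1) w]]
    by (auto intro: reparam_trans)
qed

text \<open>Since a thin path is the path of its word up to reparametrization, and words are determined by
  their paths, thin paths are compared by comparing words.\<close>

lemma mclass_thin_path_eq_iff: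
  assumes d: "labelled_thin K (cells K) {0..1} us fs ts" "labelled_thin K (cells K) {0..1} us' fs' ts'"
  shows "mclass (thin_path K (us, fs) ts) = mclass (thin_path K (us', fs') ts') \<longleftrightarrow>
    path1_init (hd us) = path1_init (hd us') \<and> thin_letters K us fs ts = thin_letters K us' fs' ts'"
proof -
  note r = reparam_thin_path_word[OF d(1), folded mclass_eq_iff]
    reparam_thin_path_word[OF d(2), folded mclass_eq_iff]
  show ?thesis unfolding r unfolding mclass_eq_iff
    using word_path_inject[OF thin_letters_word[OF d(1)] thin_letters_word[OF d(2)]] reparam_refl
    by metis
qed

lemma thin_path_pos_product:
  assumes "labelled_thin K (cells K) {0..1} us fs ts"
  shows "thin_path K (us, fs) ts \<in> pos_products K"
  using assms
proof induction
  case (path u)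
  then have "walk_path K u \<in> elem_paths K" unfolding elem_paths_def by blast
  then show ?case by (simp add: pos_products.intros(1))
next
  case (cell us fs ts u f t)
  have f: "cell_path K f t \<in> elem_paths K" using cell.hyps by (auto simp: elem_paths_def)
  have u: "walk_path K u \<in> elem_paths K" using cell.hyps(2) unfolding elem_paths_def by blast
  note e = cell_path_ends_vertex[OF cell.hyps(3,4)]
  have "mend (cell_path K f t) = mstart (thin_path K (us, fs) ts)"
    using e(2) thin_path_start[OF cell.hyps(1)] cell.hyps(6) by (simp add: mend_def cell_path_def)
  then have 1: "cell_path K f t \<star> thin_path K (us, fs) ts \<in> pos_products K"
    using f cell.IH by (intro pos_products.intros(2))
  have "mend (walk_path K u) = mstart (cell_path K f t \<star> thin_path K (us, fs) ts)"
    using e(1) walk_path_end[OF cell.hyps(2)] cell.hyps(5)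
    by (simp add: mstart_def mmult_def cell_path_def)
  then show ?case using u 1 by (auto intro: pos_products.intros(2))
qed

end

section \<open>Normal forms\<close>

context directed_2_complex
begin

lemma elem_path_word:
  assumes "p \<in> elem_paths K"
  shows "\<exists>v ls w. is_word K v ls w \<and> reparam p (word_path K v ls) \<and> 0 \<le> fst p \<and>
    mstart p = cpoint K (Vertex v) \<and> mend p = cpoint K (Vertex w)"
  using assms unfolding elem_paths_def
proof (elim UnE CollectE exE conjE)
  fix u assume u: "p = walk_path K u" "u \<in> paths1 (dgraph K)"
  have "reparam p (word_path K (path1_init u) (map Arc_Letter (snd u)))"
    unfolding u(1) walk_path_word path1_init_def by (rule reparam_refl)
  then show ?thesis
    using is_word_path1[OF u(2)] walk_path_start[OF u(2)] walk_path_end[OF u(2)] u(1)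
    by (metis fst_word_path of_nat_0_le_iff walk_path_word)
next
  fix f t assume p: "p = cell_path K f t" and f: "f \<in> cells K" "t \<in> {0..1}"
  have "fst p = 1" by (simp add: p cell_path_def)
  then show ?thesis
    using cell_path_word[OF f] cell_path_ends_vertex[OF f] p by (auto simp: mstart_def mend_def)
qed

text \<open>A factor only meets the next one in the realization, where distinct vertices remain distinct; hence
  the words of composable factors are composable.\<close>

lemma pos_product_word:
  assumes "p \<in> pos_products K"
  shows "\<exists>v ls w. is_word K v ls w \<and> reparam p (word_path K v ls) \<and> 0 \<le> fst p \<and>
    mstart p = cpoint K (Vertex v)"
  using assms
proof induction
  case (1 p)
  then show ?case using elem_path_word by blast
next
  case (2 p q)
  obtain v ls w where p: "is_word K v ls w" "reparam p (word_path K v ls)" "0 \<le> fst p"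
    "mstart p = cpoint K (Vertex v)" "mend p = cpoint K (Vertex w)"
    using elem_path_word[OF 2(1)] by blast
  obtain v' ls' w' where q: "is_word K v' ls' w'" "reparam q (word_path K v' ls')" "0 \<le> fst q"
    "mstart q = cpoint K (Vertex v')"
    using 2 by blast
  have "v' = w" using p(5) q(4) 2(3) Vertex_cpoint_inject by metis
  then have "reparam (p \<star> q) (word_path K v (ls @ ls'))"
    using reparam_trans[OF reparam_mmult[OF p(2) q(2)]] word_path_append[OF p(1)] p(3) q(1,3)
    by (simp add: fst_word_path)
  moreover have "0 \<le> fst (p \<star> q)" "mstart (p \<star> q) = cpoint K (Vertex v)"
    using p q by (simp_all add: mmult_def mstart_def)
  ultimately show ?case using is_word_append[OF p(1)] q(1) \<open>v' = w\<close> by blast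
qed

text \<open>The normal form groups the arcs between two consecutive cell letters into one 1-path. Reading from
  the right, an arc is put in front of the first 1-path, and a cell letter opens a new, empty one.\<close>

lemma word_normal_form:
  assumes "is_word K v ls w"
  shows "\<exists>us fs ts. labelled_thin K (neg_cells K) {0<..<1} us fs ts \<and>
    path1_init (hd us) = v \<and> thin_letters K us fs ts = ls"
  using assms
proof (induction ls arbitrary: v)
  case Nil
  then have "labelled_thin K (neg_cells K) {0<..<1} [(v, [])] [] []"
    by (intro labelled_thin.path) (simp add: paths1_Nil)
  then show ?case by (intro exI conjI) (auto simp: path1_init_def)
next
  case (Cons l ls)
  then obtain us fs ts where d: "labelled_thin K (neg_cells K) {0<..<1} us fs ts"
    and i: "path1_init (hd us) = letter_term K l" and ls: "thin_letters K us fs ts = ls"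
    by (auto dest: Cons.IH)
  show ?case
  proof (cases l)
    case (Arc_Letter e)
    obtain u us' where us: "us = u # us'" using d by cases auto
    let ?u = "(v, e # snd u)"
    have e: "e \<in> arcs (dgraph K)" "v = tail (dgraph K) e" "path1_init u = head (dgraph K) e"
      using Cons.prems i Arc_Letter us by auto
    have "u = (head (dgraph K) e, snd u)" using e(3) by (simp add: path1_init_def prod_eq_iff)
    then have u: "u \<in> paths1 (dgraph K) \<Longrightarrow> ?u \<in> paths1 (dgraph K)"
      "path1_term (dgraph K) ?u = path1_term (dgraph K) u"
      using e(1,2) by (simp_all add: paths1_Cons path1_term_simps)
    have "labelled_thin K (neg_cells K) {0<..<1} (?u # us') fs ts"
      using d[unfolded us] by cases (auto intro!: labelled_thin.intros simp: u)
    moreover have "thin_letters K (?u # us') fs ts = l # ls"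
      using ls by (cases fs) (auto simp: us Arc_Letter)
    ultimately show ?thesis by (intro exI conjI) (auto simp: path1_init_def)
  next
    case (Cell_Letter f t)
    have f: "f \<in> neg_cells K" "t \<in> {0<..<1}" "v = cell_init K f" using Cons.prems Cell_Letter by auto
    have "v \<in> verts (dgraph K)" using Cons.prems is_letter_ends_in_verts by auto
    then have "labelled_thin K (neg_cells K) {0<..<1} ((v, []) # us) (f # fs) (t # ts)"
      using d f i Cell_Letter by (intro labelled_thin.cell) (auto simp: paths1_Nil path1_term_simps)
    moreover have "thin_letters K ((v, []) # us) (f # fs) (t # ts) = l # ls"
      using f ls by (simp add: Cell_Letter cell_letters_def neg_cells_iff)
    ultimately show ?thesis by (intro exI conjI) (auto simp: path1_init_def)
  qed
qed

text \<open>In a normal form each cell contributes exactly one cell letter, so the cell letters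
  show where the 1-paths are to be cut; the initial vertices of the 1-paths are those given by the
  preceding cells.\<close>

lemma normal_form_determined_by_word:
  assumes "labelled_thin K (neg_cells K) {0<..<1} us fs ts"
    and "labelled_thin K (neg_cells K) {0<..<1} us' fs' ts'"
    and "path1_init (hd us) = path1_init (hd us')"
    and "thin_letters K us fs ts = thin_letters K us' fs' ts'"
  shows "us = us' \<and> fs = fs' \<and> ts = ts'"
  using assms
proof (induction arbitrary: us' fs' ts')
  case (path u)
  from path.prems(1) show ?case
  proof cases
    case (path u')
    with path.prems show ?thesis
      by (auto simp: path1_init_def prod_eq_iff dest!: map_injective intro: injI)
  next
    case (cell us2 fs2 ts2 u2 f2 t2)
    then have "Cell_Letter f2 t2 \<in> set (thin_letters K us' fs' ts')"
      by (simp add: cell_letters_def neg_cells_iff)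
    then show ?thesis unfolding path.prems(3)[symmetric] by auto
  qed
next
  case (cell us fs ts u f t)
  have l: "thin_letters K (u # us) (f # fs) (t # ts) =
      map Arc_Letter (snd u) @ Cell_Letter f t # thin_letters K us fs ts"
    using cell.hyps by (simp add: cell_letters_def neg_cells_iff)
  from cell.prems(1) show ?case
  proof cases
    case (path u')
    have "Cell_Letter f t \<in> set (thin_letters K (u # us) (f # fs) (t # ts))" unfolding l by simp
    then show ?thesis unfolding cell.prems(3) path by auto
  next
    case (cell us2 fs2 ts2 u2 f2 t2)
    have split: "a = a' \<and> g = g' \<and> s = s' \<and> r = r'"
      if "map Arc_Letter a @ Cell_Letter g s # r = map Arc_Letter a' @ Cell_Letter g' s' # r'"
      for a a' :: "'e list" and g g' :: 'f and s s' r r'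
      using that
    proof (induction a arbitrary: a')
      case Nil then show ?case by (cases a') auto
    next
      case (Cons e a) then show ?case by (cases a') auto
    qed
    have "thin_letters K us' fs' ts' =
        map Arc_Letter (snd u2) @ Cell_Letter f2 t2 # thin_letters K us2 fs2 ts2"
      using cell by (simp add: cell_letters_def neg_cells_iff)
    with l cell.prems(3) have eq: "snd u = snd u2" "f = f2" "t = t2"
      "thin_letters K us fs ts = thin_letters K us2 fs2 ts2"
      using split by metis+
    moreover have "us = us2 \<and> fs = fs2 \<and> ts = ts2"
      using cell.IH[OF cell(4) _ eq(4)] cell.hyps cell eq by simp
    moreover have "fst u = fst u2" using cell.prems(2) cell by (simp add: path1_init_def)
    ultimately show ?thesis using cell by (simp add: prod_eq_iff)
  qed
qed

end

section \<open>Words of the points of the Squier complex\<close>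

lemma thin_letters_prepend:
  "thin_letters K ((w \<cdot>\<^sub>1 u) # us) fs ts = map Arc_Letter (snd w) @ thin_letters K (u # us) fs ts"
  by (cases fs) (simp_all add: path1_mult_def)

text \<open>A face map replaces a cell by its top or bottom path, and the word does the same with a cell whose
  coordinate is 0 or 1. The index \<open>i\<close> counts from 0 as in lists, whereas face maps count
  from 1.\<close>

lemma thin_letters_face:
  assumes "length us = length fs + 1" "length ts = length fs" "i < length fs"
    and "k \<in> {0, 1}" "ts ! i = real k"
  shows "fst (hd (fst (thin_face K (Suc i) k (us, fs)))) = fst (hd us) \<and>
    thin_letters K (fst (thin_face K (Suc i) k (us, fs))) (snd (thin_face K (Suc i) k (us, fs)))
      (take i ts @ drop (Suc i) ts) = thin_letters K us fs ts"
  using assms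
proof (induction i arbitrary: us fs ts)
  case 0
  then obtain f fs' where fs: "fs = f # fs'" by (cases fs) auto
  with 0 obtain t ts' where ts: "ts = t # ts'" by (cases ts) auto
  from 0 fs obtain u us1 where us1: "us = u # us1" by (cases us) auto
  with 0 fs obtain u' us' where us: "us = u # u' # us'" by (cases us1) auto
  from 0 ts have "k = 0 \<and> t = 0 \<or> k = 1 \<and> t = 1" by auto
  then show ?case
    by (auto simp: fs ts us thin_letters_prepend cell_letters_def) (simp_all add: path1_mult_def)
next
  case (Suc i)
  then obtain f fs' where fs: "fs = f # fs'" by (cases fs) auto
  with Suc.prems obtain t ts' where ts: "ts = t # ts'" by (cases ts) auto
  from Suc.prems fs obtain u us' where us: "us = u # us'" by (cases us) auto
  have "thin_letters K (fst (thin_face K (Suc i) k (us', fs'))) (snd (thin_face K (Suc i) k (us', fs')))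
      (take i ts' @ drop (Suc i) ts') = thin_letters K us' fs' ts'"
    using Suc.IH[of us' fs' ts'] Suc.prems by (simp add: fs ts us)
  then show ?case by (simp add: fs ts us)
qed

fun point_word :: "('v, 'e, 'f) dir_complex \<Rightarrow> ('v, 'e, 'f) thin \<times> real list \<Rightarrow> 'v \<times> ('e, 'f) letter list" where
  "point_word K ((us, fs), ts) = (path1_init (hd us), thin_letters K us fs ts)"

lemma real_point_eq_iff: "real_point S x ts = real_point S y ts' \<longleftrightarrow> equivclp (face_glue S) (x, ts) (y, ts')"
proof
  assume eq: "real_point S x ts = real_point S y ts'"
  have "(y, ts') \<in> real_point S y ts'" by (simp add: real_point_def)
  then show "equivclp (face_glue S) (x, ts) (y, ts')" unfolding eq[symmetric] by (simp add: real_point_def)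
next
  assume "equivclp (face_glue S) (x, ts) (y, ts')"
  then show "real_point S x ts = real_point S y ts'"
    unfolding real_point_def by (intro Collect_cong) (metis equivclp_sym equivclp_trans)
qed

lemma cube_points_Sq_iff:
  "((us, fs), ts) \<in> cube_points (Sq K) \<longleftrightarrow> labelled_thin K (neg_cells K) {0..1} us fs ts"
  by (auto simp: cube_points_def Sq_def labelled_thin_iff)

lemma face_glue_point_word: "face_glue (Sq K) x y \<Longrightarrow> point_word K x = point_word K y"
proof (induction rule: face_glue.induct)
  case (1 c ts i k)
  obtain us fs where c: "c = (us, fs)" by fastforce
  with 1(1) have len: "length us = length fs + 1" "length ts = length fs"
    by (auto simp: cube_points_Sq_iff labelled_thin_iff thin_diagrams_def)
  obtain j where j: "i = Suc j" using 1(2) by (cases i) auto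
  obtain us' fs' where face: "thin_face K (Suc j) k (us, fs) = (us', fs')" by fastforce
  show ?case
    using thin_letters_face[OF len, of j k K, unfolded face] 1 len
    by (simp add: c j Sq_def face path1_init_def del: thin_face.simps)
qed

lemma equivclp_point_word: "equivclp (face_glue (Sq K)) x y \<Longrightarrow> point_word K x = point_word K y"
  by (induction rule: equivclp_induct) (auto dest: face_glue_point_word)

context directed_2_complex
begin

text \<open>Passing to a face for each coordinate that is 0 or 1 moves a point into the interior of a cube;
  this ends because every face has one coordinate less.\<close>

lemma cube_point_normal_form:
  assumes "(c, ts) \<in> cube_points (Sq K)"
  shows "\<exists>us fs ts'. labelled_thin K (neg_cells K) {0<..<1} us fs ts' \<and>
    equivclp (face_glue (Sq K)) (c, ts) ((us, fs), ts')"
  using assms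
proof (induction "length ts" arbitrary: c ts rule: less_induct)
  case less
  obtain us fs where c: "c = (us, fs)" by fastforce
  show ?case
  proof (cases "set ts \<subseteq> {0<..<1}")
    case True
    then have "labelled_thin K (neg_cells K) {0<..<1} us fs ts"
      using less.prems by (simp add: c cube_points_Sq_iff labelled_thin_iff)
    then show ?thesis unfolding c by (intro exI conjI) (auto intro: equivclp_refl)
  next
    case False
    then obtain t where t: "t \<in> set ts" "t \<notin> {0<..<1}" by blast
    then obtain j where j: "j < length ts" "ts ! j = t" by (metis in_set_conv_nth)
    have "t \<in> {0..1}" using t less.prems by (auto simp: cube_points_def)
    with t have "t = 0 \<or> t = 1" by force
    then obtain k :: nat where k: "k \<in> {0, 1}" "t = real k"
      by (metis insertCI of_nat_0 of_nat_1)
    define y where "y = face (Sq K) (Suc j) k c"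
    define ts' where "ts' = take j ts @ drop (Suc j) ts"
    have glue: "face_glue (Sq K) (c, ts) (y, ts')"
      using face_glue.intros[OF less.prems, of "Suc j" k] j k by (simp add: y_def ts'_def)
    have "y \<in> cubes (Sq K) (length ts - 1)"
      unfolding y_def using less.prems j k
      by (intro semi_cubical_complex.face_cube[OF semi_cubical_Sq]) (auto simp: cube_points_def)
    moreover have "length ts' = length ts - 1" "set ts' \<subseteq> set ts"
      using j by (auto simp: ts'_def dest: in_set_takeD in_set_dropD)
    ultimately have "(y, ts') \<in> cube_points (Sq K)" "length ts' < length ts"
      using less.prems j by (auto simp: cube_points_def)
    from less.hyps[OF this(2,1)] show ?thesis
      using r_into_equivclp[of "face_glue (Sq K)", OF glue] equivclp_trans by metis
  qed
qed

end

section \<open>The map from positive paths to the Squier complex\<close>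

context directed_2_complex
begin

text \<open>Replacing \<open>f\<^sub>t\<close> by \<open>(f\<^sup>-\<^sup>1)\<^sub>1\<^sub>-\<^sub>t\<close>
  for the positive cells turns a diagram with arbitrary cells into a point of a cube with the same
  word.\<close>

lemma negate_labelled_thin:
  assumes "labelled_thin K (cells K) {0..1} us fs ts"
  defines "fs' \<equiv> map (\<lambda>f. if f \<in> pos_cells K then cinv K f else f) fs"
    and "ts' \<equiv> map2 (\<lambda>f t. if f \<in> pos_cells K then 1 - t else t) fs ts"
  shows "labelled_thin K (neg_cells K) {0..1} us fs' ts' \<and>
    thin_letters K us fs' ts' = thin_letters K us fs ts"
  using assms(1) unfolding fs'_def ts'_def
proof induction
  case (path u)
  then show ?case by (simp add: labelled_thin.path)
next
  case (cell us fs ts u f t)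
  let ?f = "if f \<in> pos_cells K then cinv K f else f"
  let ?t = "if f \<in> pos_cells K then 1 - t else t"
  have "?f \<in> neg_cells K" "?t \<in> {0..1}" "cell_init K ?f = cell_init K f" "cell_term K ?f = cell_term K f"
    using cell.hyps by (auto simp: neg_cells_iff inv_cell cinv_pos_iff cell_init_inv cell_term_inv)
  moreover have "cell_letters K ?f ?t = cell_letters K f t"
    using cell.hyps(3) by (auto simp: cell_letters_def top_inv bot_inv cinv_pos_iff)
  ultimately show ?case using cell by (auto intro!: labelled_thin.cell)
qed

lemma normal_form_iff:
  "normal_form K p (us, fs) ts \<longleftrightarrow>
    labelled_thin K (neg_cells K) {0<..<1} us fs ts \<and> p = mclass (thin_path K (us, fs) ts)"
  by (auto simp: normal_form_def labelled_thin_iff)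

lemma labelled_thin_weaken:
  assumes "labelled_thin K (neg_cells K) {0<..<1} us fs ts"
  shows "labelled_thin K (neg_cells K) {0..1} us fs ts" "labelled_thin K (cells K) {0..1} us fs ts"
  using assms neg_cells_subset by (auto intro: labelled_thin_mono)

lemma xi_normal_form:
  assumes d: "labelled_thin K (neg_cells K) {0<..<1} us fs ts"
  shows "xi K (mclass (thin_path K (us, fs) ts)) = real_point (Sq K) (us, fs) ts"
proof -
  let ?p = "mclass (thin_path K (us, fs) ts)"
  have "c = (us, fs) \<and> ts' = ts" if "normal_form K ?p c ts'" for c ts'
  proof -
    obtain us' fs' where c: "c = (us', fs')" by fastforce
    with that have d': "labelled_thin K (neg_cells K) {0<..<1} us' fs' ts'"
      and "?p = mclass (thin_path K (us', fs') ts')" by (simp_all add: normal_form_iff)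
    then show ?thesis
      using normal_form_determined_by_word[OF d d']
        mclass_thin_path_eq_iff[OF labelled_thin_weaken(2)[OF d] labelled_thin_weaken(2)[OF d']] c
      by simp
  qed
  moreover have "normal_form K ?p (us, fs) ts" using d by (simp add: normal_form_iff)
  ultimately have "(THE (c, ts). normal_form K ?p c ts) = ((us, fs), ts)"
    by (intro the_equality) auto
  then show ?thesis by (simp add: xi_def)
qed

lemma Omega_plus_normal_form:
  assumes "p \<in> Omega_plus K"
  obtains us fs ts where "labelled_thin K (neg_cells K) {0<..<1} us fs ts"
    "p = mclass (thin_path K (us, fs) ts)"
proof -
  obtain q where q: "p = mclass q" "q \<in> pos_products K" using assms by (auto simp: Omega_plus_def)
  obtain v ls w where w: "is_word K v ls w" "reparam q (word_path K v ls)"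
    using pos_product_word[OF q(2)] by blast
  obtain us fs ts where n: "labelled_thin K (neg_cells K) {0<..<1} us fs ts"
    "path1_init (hd us) = v" "thin_letters K us fs ts = ls"
    using word_normal_form[OF w(1)] by blast
  have "p = mclass (thin_path K (us, fs) ts)"
    using reparam_thin_path_word[OF labelled_thin_weaken(2)[OF n(1)]] n w(2) q(1)
    by (simp add: mclass_eq_iff) (metis reparam_sym reparam_trans)
  with n(1) show thesis by (rule that)
qed

text \<open>The point with the given coordinates is glued to one in the interior of a cube, without a change
  of the word. The latter is a normal form of the path, because it has the word of the path, and so
  it is the one that defines the image of the path.\<close>

lemma xi_thin_path:
  assumes d: "labelled_thin K (cells K) {0..1} us fs ts"
  shows "xi K (mclass (thin_path K (us, fs) ts)) = thin_point K (us, fs) ts"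
proof -
  let ?fs = "map (\<lambda>f. if f \<in> pos_cells K then cinv K f else f) fs"
  let ?ts = "map2 (\<lambda>f t. if f \<in> pos_cells K then 1 - t else t) fs ts"
  have neg: "((us, ?fs), ?ts) \<in> cube_points (Sq K)"
    "point_word K ((us, ?fs), ?ts) = point_word K ((us, fs), ts)"
    using negate_labelled_thin[OF d] by (simp_all add: cube_points_Sq_iff)
  obtain us' fs' ts' where n: "labelled_thin K (neg_cells K) {0<..<1} us' fs' ts'"
    and glue: "equivclp (face_glue (Sq K)) ((us, ?fs), ?ts) ((us', fs'), ts')"
    using cube_point_normal_form[OF neg(1)] by blast
  have "point_word K ((us, fs), ts) = point_word K ((us', fs'), ts')"
    using equivclp_point_word[OF glue] neg(2) by simp
  then have "mclass (thin_path K (us, fs) ts) = mclass (thin_path K (us', fs') ts')"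
    using mclass_thin_path_eq_iff[OF d labelled_thin_weaken(2)[OF n]] by simp
  then show ?thesis
    using xi_normal_form[OF n] glue by (simp add: thin_point_def real_point_eq_iff[symmetric])
qed

lemma bij_betw_xi: "bij_betw (xi K) (Omega_plus K) (realization (Sq K))"
proof (rule bij_betw_imageI)
  show "inj_on (xi K) (Omega_plus K)"
  proof (rule inj_onI)
    fix p q assume pq: "p \<in> Omega_plus K" "q \<in> Omega_plus K" "xi K p = xi K q"
    obtain us fs ts where p: "labelled_thin K (neg_cells K) {0<..<1} us fs ts"
      "p = mclass (thin_path K (us, fs) ts)"
      using pq(1) by (rule Omega_plus_normal_form)
    obtain us' fs' ts' where q: "labelled_thin K (neg_cells K) {0<..<1} us' fs' ts'"
      "q = mclass (thin_path K (us', fs') ts')"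
      using pq(2) by (rule Omega_plus_normal_form)
    have "point_word K ((us, fs), ts) = point_word K ((us', fs'), ts')"
      using pq(3) xi_normal_form[OF p(1)] xi_normal_form[OF q(1)] p(2) q(2)
      by (intro equivclp_point_word) (simp add: real_point_eq_iff)
    then show "p = q"
      using mclass_thin_path_eq_iff[OF labelled_thin_weaken(2)[OF p(1)] labelled_thin_weaken(2)[OF q(1)]]
        p(2) q(2) by simp
  qed
  show "xi K ` Omega_plus K = realization (Sq K)"
  proof (intro equalityI subsetI)
    fix P assume "P \<in> xi K ` Omega_plus K"
    then obtain p where "p \<in> Omega_plus K" "P = xi K p" by blast
    moreover obtain us fs ts where n: "labelled_thin K (neg_cells K) {0<..<1} us fs ts"
      "p = mclass (thin_path K (us, fs) ts)"
      using \<open>p \<in> Omega_plus K\<close> by (rule Omega_plus_normal_form)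
    ultimately have "P = real_point (Sq K) (us, fs) ts" by (simp add: xi_normal_form)
    then show "P \<in> realization (Sq K)"
      using labelled_thin_weaken(1)[OF n(1)] unfolding realization_def cube_points_Sq_iff[symmetric] by blast
  next
    fix P assume "P \<in> realization (Sq K)"
    then obtain c ts where P: "P = real_point (Sq K) c ts" "(c, ts) \<in> cube_points (Sq K)"
      unfolding realization_def by blast
    obtain us fs ts' where n: "labelled_thin K (neg_cells K) {0<..<1} us fs ts'"
      "equivclp (face_glue (Sq K)) (c, ts) ((us, fs), ts')"
      using cube_point_normal_form[OF P(2)] by blast
    have "P = xi K (mclass (thin_path K (us, fs) ts'))"
      using n P(1) by (simp add: xi_normal_form real_point_eq_iff)
    moreover have "mclass (thin_path K (us, fs) ts') \<in> Omega_plus K"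
      using thin_path_pos_product[OF labelled_thin_weaken(2)[OF n(1)]] by (simp add: Omega_plus_def)
    ultimately show "P \<in> xi K ` Omega_plus K" by blast
  qed
qed

end

theorem lemma3p7:
  fixes K :: "('v, 'e, 'f) dir_complex"
  assumes "directed_2_complex K"
  shows "bij_betw (xi K) (Omega_plus K) (realization (Sq K)) \<and>
    (\<forall>p \<in> Omega_plus K. \<forall>us fs ts.
       (us, fs) \<in> thin_diagrams K (cells K) \<and> length ts = length fs \<and> set ts \<subseteq> {0..1} \<and>
       p = mclass (thin_path K (us, fs) ts) \<longrightarrow>
       xi K p = thin_point K (us, fs) ts)"
proof -
  interpret directed_2_complex K by (rule assms)
  show ?thesis
    using bij_betw_xi xi_thin_path by (auto simp: labelled_thin_iff)
qed

end
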